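(* Let $m,n,r$ be positive integers with $r<\min\{m,n\}$, let $f:\mathbb{R}^{m\times n}\to\mathbb{R}$ be differentiable with $\nabla f$ locally Lipschitz continuous, let $0<\underline{\alpha}\le\bar{\alpha}<\infty$, $\beta,c\in(0,1)$, $\Delta\in(0,\infty)$, and $X_0\in\mathbb{R}^{m\times n}_{\le r}$. Consider a sequence generated by the algorithm $\mathrm{RFDR}$ from $X_0$ with these parameters: starting with $i=0$, as long as $\mathrm{s}(X_i;f,\mathbb{R}^{m\times n}_{\le r})>0$, choose any $X_{i+1}\in\mathrm{RFDR}(X_i;f,r,\underline{\alpha},\bar{\alpha},\beta,c,\Delta)$ and increase $i$ by one; stop if $\mathrm{s}(X_i;f,\mathbb{R}^{m\times n}_{\le r})=0$. If this sequence is finite, then its last element is stationary, i.e., is a zero of $\mathrm{s}(\cdot;f,\mathbb{R}^{m\times n}_{\le r})$. If it is infinite, then each of its accumulation points is stationary, i.e., is a zero of $\mathrm{s}(\cdot;f,\mathbb{R}^{m\times n}_{\le r})$.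
   Context: $\mathbb{R}^{m\times n}$ carries the Frobenius inner product $\langle\cdot,\cdot\rangle$ and norm $\|\cdot\|$. $\mathbb{R}^{m\times n}_{\le r}:=\{X\in\mathbb{R}^{m\times n}\mid \operatorname{rank}X\le r\}$ and $\mathbb{R}^{m\times n}_{k}:=\{X\mid\operatorname{rank}X=k\}$. $\sigma_1(X)\ge\sigma_2(X)\ge\dots$ are the singular values of $X$. For a nonempty set $S\subseteq\mathbb{R}^{m\times n}$, $P_S(Z):=\operatorname{argmin}_{Y\in S}\|Z-Y\|$ is the (set-valued) metric projection of $Z$ onto $S$; when $S$ is a closed cone, all elements of $P_S(Z)$ have the same norm, denoted $\|P_S(Z)\|$. Tangent cone and restricted tangent cone. Let $X\in\mathbb{R}^{m\times n}_{\le r}$ have rank $\underline{r}\ge1$, and let $[U\;U_\perp]\in\mathbb{R}^{m\times m}$ and $[V\;V_\perp]\in\mathbb{R}^{n\times n}$ be orthogonal matrices such that the columns of $U\in\mathbb{R}^{m\times\underline{r}}$ span $\operatorname{im}X$ and those of $V\in\mathbb{R}^{n\times\underline{r}}$ span $\operatorname{im}X^\top$. The tangent cone $T_{\mathbb{R}^{m\times n}_{\le r}}(X)$ is the set of all matrices $[U\;U_\perp]\begin{bmatrix}A&B\\C&D\end{bmatrix}[V\;V_\perp]^\top$ with $A\in\mathbb{R}^{\underline{r}\times\underline{r}}$, $B\in\mathbb{R}^{\underline{r}\times(n-\underline{r})}$, $C\in\mathbb{R}^{(m-\underline{r})\times\underline{r}}$, $D\in\mathbb{R}^{(m-\underline{r})\times(n-\underline{r})}$,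 $\operatorname{rank}D\le r-\underline{r}$. The restricted tangent cone $\breve{T}_{\mathbb{R}^{m\times n}_{\le r}}(X)$ is the subset of those matrices for which, in addition, $B=0$ or $C=0$. For $X=0$, both cones are $\mathbb{R}^{m\times n}_{\le r}$. These cones do not depend on the choice of $U,U_\perp,V,V_\perp$. Stationarity measure: $\mathrm{s}(X;f,\mathbb{R}^{m\times n}_{\le r}):=\|P_{T_{\mathbb{R}^{m\times n}_{\le r}}(X)}(-\nabla f(X))\|$ for $X\in\mathbb{R}^{m\times n}_{\le r}$. RFD map: $\mathrm{RFD}(X;f,r,\underline{\alpha},\bar{\alpha},\beta,c)$ is the set of all points that can be produced from $X\in\mathbb{R}^{m\times n}_{\le r}$ as follows: choose $G\in P_{\breve{T}_{\mathbb{R}^{m\times n}_{\le r}}(X)}(-\nabla f(X))$ and $\alpha\in[\underline{\alpha},\bar{\alpha}]$; while $f(X+\alpha G)>f(X)-c\,\alpha\|G\|^2$, replace $\alpha$ by $\alpha\beta$; return $X+\alpha G$. (If $G=0$, the output is $X$.) RFDR map: $\mathrm{RFDR}(X;f,r,\underline{\alpha},\bar{\alpha},\beta,c,\Delta)$ is the set of all points that can be produced from $X\in\mathbb{R}^{m\times n}_{\le r}$ as follows: choose $\tilde{X}\in\mathrm{RFD}(X;f,r,\underline{\alpha},\bar{\alpha},\beta,c)$. If $\sigma_r(X)\in(0,\Delta]$, choose $\hat{X}\in P_{\mathbb{R}^{m\times n}_{r-1}}(X)$, choose $\tilde{X}^{\mathrm{R}}\in\mathrm{RFD}(\hat{X};f,r,\underline{\alpha},\bar{\alpha},\beta,c)$,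 and return some $Y\in\operatorname{argmin}_{\{\tilde{X},\tilde{X}^{\mathrm{R}}\}}f$; otherwise return $\tilde{X}$. *)

theory Defs
  imports "HOL-Analysis.Analysis" "HOL-Library.While_Combinator" "HOL-Library.Extended_Nat"
begin

text \<open>
  Matrices with m rows and n columns have type \<open>real^'n^'m\<close>, with \<open>m = CARD('m)\<close> and \<open>n = CARD('n)\<close>.
  The library's inner product and norm on this type are the Frobenius ones.
\<close>

definition rank_le :: "nat \<Rightarrow> (real^'n^'m) set" where
  "rank_le r = {X. rank X \<le> r}"

definition rank_eq :: "nat \<Rightarrow> (real^'n^'m) set" where
  "rank_eq k = {X. rank X = k}"

definition metric_projection :: "'a::metric_space set \<Rightarrow> 'a \<Rightarrow> 'a set" where
  "metric_projection S Z = {Y. is_arg_min (\<lambda>Y. dist Z Y) (\<lambda>Y. Y \<in> S) Y}"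

text \<open>
  The singular values of an m by n matrix are the square roots of the eigenvalues of
  \<open>transpose X ** X\<close>, repeated according to multiplicity (algebraic and geometric multiplicity
  agree, this matrix being symmetric). The list below is nonincreasing and has length n; its first
  \<open>min m n\<close> entries are the singular values, any remaining ones are zero.
\<close>

definition sv_eigenspace :: "real^'n^'m \<Rightarrow> real \<Rightarrow> (real^'n) set" where
  "sv_eigenspace X s = {v. (transpose X ** X) *v v = s\<^sup>2 *\<^sub>R v}"

definition singular_values :: "real^'n^'m \<Rightarrow> real list" where
  "singular_values X =
     rev (sorted_list_of_multiset
       (\<Sum>s\<in>{s. 0 \<le> s \<and> (\<exists>v\<in>sv_eigenspace X s. v \<noteq> 0)}.
          replicate_mset (dim (sv_eigenspace X s)) s))"

definition singular_value :: "nat \<Rightarrow> real^'n^'m \<Rightarrow> real" where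
  "singular_value k X = singular_values X ! (k - 1)"

text \<open>The index set of the sum in \<open>singular_values\<close> is indeed finite.\<close>

lemma finite_singular_values:
  fixes X :: "real^'n^'m"
  shows "finite {s. 0 \<le> s \<and> (\<exists>v\<in>sv_eigenspace X s. v \<noteq> 0)}" (is "finite ?S")
proof -
  obtain v where "\<forall>s\<in>?S. v s \<in> sv_eigenspace X s \<and> v s \<noteq> 0"
    using bchoice[of ?S "\<lambda>s v. v \<in> sv_eigenspace X s \<and> v \<noteq> 0"] by blast
  then have v: "v s \<in> sv_eigenspace X s" "v s \<noteq> 0" if "s \<in> ?S" for s
    using that by blast+
  have eig: "(transpose X ** X) *v v s = s\<^sup>2 *\<^sub>R v s" if "s \<in> ?S" for s
    using v(1)[OF that] by (simp only: sv_eigenspace_def mem_Collect_eq)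
  have sym: "((transpose X ** X) *v a) \<bullet> b = a \<bullet> ((transpose X ** X) *v b)" for a b
    by (metis (no_types, lifting) dot_lmul_matrix transpose_matrix_vector
        vector_matrix_mul_assoc vector_transpose_matrix)
  have orth: "v s \<bullet> v t = 0" if "s \<in> ?S" "t \<in> ?S" "s \<noteq> t" for s t
  proof -
    have "s\<^sup>2 * (v s \<bullet> v t) = t\<^sup>2 * (v s \<bullet> v t)"
      using sym[of "v s" "v t"] eig[OF that(1)] eig[OF that(2)] by simp
    moreover have "s\<^sup>2 \<noteq> t\<^sup>2"
      using that by (simp only: mem_Collect_eq power2_eq_iff_nonneg) argo
    ultimately show ?thesis by (simp only: mult_cancel_right) argo
  qed
  have inj: "inj_on v ?S"
  proof (rule inj_onI)
    fix s t assume st: "s \<in> ?S" "t \<in> ?S" "v s = v t"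
    then have "v s \<bullet> v t \<noteq> 0" using v(2)[OF st(1)] by simp
    then show "s = t" using orth[OF st(1,2)] by argo
  qed
  have "pairwise orthogonal (v ` ?S)"
    unfolding pairwise_def orthogonal_def using orth by blast
  moreover have "0 \<notin> v ` ?S"
    using v(2) by force
  ultimately have "independent (v ` ?S)"
    by (rule pairwise_orthogonal_independent)
  then have "finite (v ` ?S)"
    by (rule independent_imp_finite)
  then show ?thesis
    using inj by (rule finite_imageD)
qed

text \<open>
  A block of a matrix is selected by an arbitrary set of row indices and an arbitrary set of column
  indices and kept as a zero-padded matrix of the original format, which changes neither its rank
  nor whether it vanishes. The index types carry no order, so the columns of \<open>P\<close> with index in \<open>I\<close>
  play the role of U and the other ones that of U_perp; likewise \<open>Q\<close> and \<open>J\<close> for V and V_perp.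
\<close>

definition block :: "'m set \<Rightarrow> 'n set \<Rightarrow> real^'n^'m \<Rightarrow> real^'n^'m" where
  "block I J M = (\<chi> i j. if i \<in> I \<and> j \<in> J then M $ i $ j else 0)"

definition adapted_bases ::
  "real^'n^'m \<Rightarrow> real^'m^'m \<Rightarrow> 'm set \<Rightarrow> real^'n^'n \<Rightarrow> 'n set \<Rightarrow> bool" where
  "adapted_bases X P I Q J \<longleftrightarrow>
     orthogonal_matrix P \<and> card I = rank X \<and>
     span ((\<lambda>i. column i P) ` I) = range (\<lambda>x. X *v x) \<and>
     orthogonal_matrix Q \<and> card J = rank X \<and>
     span ((\<lambda>j. column j Q) ` J) = range (\<lambda>y. transpose X *v y)"

text \<open>
  The two cones do not depend on the choice of the adapted bases, so they may be quantified
  existentially. The definitions are meant for \<open>X \<in> rank_le r\<close>.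
\<close>

definition tangent_cone :: "nat \<Rightarrow> real^'n^'m \<Rightarrow> (real^'n^'m) set" where
  "tangent_cone r X =
     (if X = 0 then rank_le r
      else {P ** M ** transpose Q | P M Q. \<exists>I J. adapted_bases X P I Q J \<and>
              rank (block (- I) (- J) M) \<le> r - rank X})"

definition restricted_tangent_cone :: "nat \<Rightarrow> real^'n^'m \<Rightarrow> (real^'n^'m) set" where
  "restricted_tangent_cone r X =
     (if X = 0 then rank_le r
      else {P ** M ** transpose Q | P M Q. \<exists>I J. adapted_bases X P I Q J \<and>
              rank (block (- I) (- J) M) \<le> r - rank X \<and>
              (block I (- J) M = 0 \<or> block (- I) J M = 0)})"

definition gradient :: "('a::real_inner \<Rightarrow> real) \<Rightarrow> 'a \<Rightarrow> 'a" where
  "gradient f x = (THE D. GDERIV f x :> D)"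

text \<open>All projections of a point onto a closed cone have the same norm; \<open>the_elem\<close> extracts it.\<close>

definition stationarity_measure :: "(real^'n^'m \<Rightarrow> real) \<Rightarrow> nat \<Rightarrow> real^'n^'m \<Rightarrow> real" where
  "stationarity_measure f r X =
     the_elem (norm ` metric_projection (tangent_cone r X) (- gradient f X))"

text \<open>The measure is a function on \<open>rank_le r\<close>, so its zeros are by definition elements of that set.\<close>

definition stationary :: "(real^'n^'m \<Rightarrow> real) \<Rightarrow> nat \<Rightarrow> real^'n^'m \<Rightarrow> bool" where
  "stationary f r X \<longleftrightarrow> X \<in> rank_le r \<and> stationarity_measure f r X = 0"

text \<open>\<open>while_option\<close> yields \<open>None\<close> if the backtracking loop does not terminate.\<close>

definition RFD ::
  "(real^'n^'m \<Rightarrow> real) \<Rightarrow> nat \<Rightarrow> real \<Rightarrow> real \<Rightarrow> real \<Rightarrow> real \<Rightarrow> real^'n^'m \<Rightarrow> (real^'n^'m) set"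
where
  "RFD f r \<alpha>\<^sub>l \<alpha>\<^sub>u \<beta> c X =
     {X + \<alpha> *\<^sub>R G | \<alpha> G. G \<in> metric_projection (restricted_tangent_cone r X) (- gradient f X) \<and>
        (\<exists>\<alpha>\<^sub>0\<in>{\<alpha>\<^sub>l..\<alpha>\<^sub>u}.
           while_option (\<lambda>a. f (X + a *\<^sub>R G) > f X - c * a * (norm G)\<^sup>2) (\<lambda>a. a * \<beta>) \<alpha>\<^sub>0 = Some \<alpha>)}"

definition RFDR ::
  "(real^'n^'m \<Rightarrow> real) \<Rightarrow> nat \<Rightarrow> real \<Rightarrow> real \<Rightarrow> real \<Rightarrow> real \<Rightarrow> real \<Rightarrow> real^'n^'m \<Rightarrow> (real^'n^'m) set"
where
  "RFDR f r \<alpha>\<^sub>l \<alpha>\<^sub>u \<beta> c \<Delta> X =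
     {Y. \<exists>X'\<in>RFD f r \<alpha>\<^sub>l \<alpha>\<^sub>u \<beta> c X.
           if singular_value r X \<in> {0<..\<Delta>}
           then \<exists>X\<^sub>h\<in>metric_projection (rank_eq (r - 1)) X. \<exists>X\<^sub>R\<in>RFD f r \<alpha>\<^sub>l \<alpha>\<^sub>u \<beta> c X\<^sub>h.
                  is_arg_min f (\<lambda>Z. Z \<in> {X', X\<^sub>R}) Y
           else Y = X'}"

text \<open>
  \<open>X\<close> is a sequence generated by the algorithm from \<open>X0\<close>; the index of its last element is \<open>N\<close>,
  with \<open>N = \<infinity>\<close> for an infinite sequence (if \<open>N\<close> is finite, the values of \<open>X\<close> beyond \<open>N\<close> are
  irrelevant). A sequence may end either because the stopping test is passed or, conceivably,
  because the iteration map has no output; that the latter does not happen is not built in.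
\<close>

definition RFDR_sequence ::
  "(real^'n^'m \<Rightarrow> real) \<Rightarrow> nat \<Rightarrow> real \<Rightarrow> real \<Rightarrow> real \<Rightarrow> real \<Rightarrow> real \<Rightarrow> real^'n^'m \<Rightarrow>
     (nat \<Rightarrow> real^'n^'m) \<Rightarrow> enat \<Rightarrow> bool"
where
  "RFDR_sequence f r \<alpha>\<^sub>l \<alpha>\<^sub>u \<beta> c \<Delta> X0 X N \<longleftrightarrow>
     X 0 = X0 \<and>
     (\<forall>i. enat i < N \<longrightarrow>
        stationarity_measure f r (X i) > 0 \<and> X (Suc i) \<in> RFDR f r \<alpha>\<^sub>l \<alpha>\<^sub>u \<beta> c \<Delta> (X i)) \<and>
     (\<forall>k. N = enat k \<longrightarrow>
        \<not> (stationarity_measure f r (X k) > 0 \<and> RFDR f r \<alpha>\<^sub>l \<alpha>\<^sub>u \<beta> c \<Delta> (X k) \<noteq> {}))"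

end

theory Submission
  imports Defs
begin

text \<open>
  The objective \<open>f\<close> decreases along the sequence, so its values at all iterates stay above its value at
  any accumulation point \<open>A\<close>. Accumulation points are therefore stationary as soon as the following
  holds: if \<open>A\<close> is not stationary, then every output of the RFDR map at a feasible point near \<open>A\<close> has a
  value of \<open>f\<close> strictly below \<open>f A\<close> (\<open>rfdr_below_near\<close>).

  By continuity of the gradient, a backtracking step from a point near \<open>A\<close> decreases \<open>f\<close> by a fixed
  amount, provided that the norm of the direction \<open>G\<close> is bounded away from zero (\<open>rfd_below_near\<close>). As
  \<open>G\<close> is a projection of the negative gradient onto a cone, its norm is at least
  \<open>- gradient f X \<bullet> W / norm W\<close> for every \<open>W\<close> in that cone. It remains to find, for \<open>X\<close> near \<open>A\<close>,
  elements of the restricted tangent cone at \<open>X\<close> whose inner product with the negative gradient does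
  not vanish as \<open>X\<close> tends to \<open>A\<close>.

  If \<open>A\<close> has rank \<open>r\<close>, the tangent cone at \<open>A\<close> consists of the matrices \<open>A ** N + M ** A\<close>, and
  \<open>X ** N\<close> and \<open>M ** X\<close> lie in the restricted tangent cone at every \<open>X\<close>; so a descent direction at
  \<open>A\<close> can be followed continuously. If \<open>A\<close> has smaller rank, this fails at nearby points of rank \<open>r\<close>,
  whose tangent cone may be much smaller than the one at \<open>A\<close>. At points \<open>X\<close> of rank less than \<open>r\<close>,
  however, every matrix \<open>W\<close> of rank one is the sum of two elements of the restricted tangent cone, its
  components in the range of \<open>X\<close> and in the orthogonal complement, and some \<open>W\<close> has positive inner
  product with the negative gradient at \<open>A\<close>. The points of rank \<open>r\<close> near \<open>A\<close> are exactly those that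
  the rank reduction takes care of: \<open>\<sigma>\<^sub>r(X) \<le> norm (X - A)\<close> is small and positive, so the algorithm
  also tries a step from a closest matrix of rank \<open>r - 1\<close>, and this matrix is again near \<open>A\<close>.

  A finite sequence ends at a stationary point because the RFDR map always has an output
  (\<open>rfdr_nonempty\<close>): the cones are closed, backtracking along a descent direction terminates, and a
  matrix of rank \<open>r\<close> has a closest matrix of rank exactly \<open>r - 1\<close>.

  The singular values enter through an orthonormal basis of eigenvectors of \<open>transpose X ** X\<close>, the
  cones through a description by orthogonal projectors that does not mention adapted bases.
\<close>

section \<open>Rank of real matrices\<close>

lemma norm_matrix_vector_mult_le:
  fixes A :: "real^'n^'m"
  shows "norm (A *v x) \<le> norm A * norm x"
proof -
  have "norm (A *v x) = L2_set (\<lambda>i. norm ((A *v x) $ i)) UNIV"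
    by (simp add: norm_vec_def)
  also have "\<dots> \<le> L2_set (\<lambda>i. norm (A $ i) * norm x) UNIV"
    by (intro L2_set_mono) (simp_all add: matrix_vector_mul_component Cauchy_Schwarz_ineq2)
  also have "\<dots> = norm A * norm x"
    by (simp add: norm_vec_def[of A] L2_set_left_distrib)
  finally show ?thesis .
qed

lemma rank_add_le:
  fixes A B :: "real^'n^'m"
  shows "rank (A + B) \<le> rank A + rank B"
proof -
  let ?S = "range ((*v) A)" and ?T = "range ((*v) B)"
  have sub: "subspace ?S" "subspace ?T"
    by (simp_all add: linear_subspace_image)
  have "range ((*v) (A + B)) \<subseteq> {x + y |x y. x \<in> ?S \<and> y \<in> ?T}"
    by (auto simp: matrix_vector_mult_add_rdistrib)
  then have "rank (A + B) \<le> dim {x + y |x y. x \<in> ?S \<and> y \<in> ?T}"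
    unfolding rank_dim_range by (rule dim_subset)
  also have "\<dots> \<le> rank A + rank B"
    using dim_sums_Int[OF sub] by (simp add: rank_dim_range)
  finally show ?thesis .
qed

lemma rank_scaleR_le:
  fixes A :: "real^'n^'m"
  shows "rank (c *\<^sub>R A) \<le> rank A"
proof -
  have "(c *\<^sub>R A) *v x = A *v (c *\<^sub>R x)" for x
    by (simp add: scaleR_matrix_vector_assoc matrix_vector_mult_scaleR)
  then have "range ((*v) (c *\<^sub>R A)) \<subseteq> range ((*v) A)"
    by auto
  then show ?thesis
    unfolding rank_dim_range by (rule dim_subset)
qed

text \<open>
  A perturbation smaller than \<open>\<mu>\<close> cannot destroy injectivity on a subspace that \<open>X\<close> shrinks by at most
  the factor \<open>\<mu>\<close>. This gives both the lower semicontinuity of the rank and the bound of singular values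
  by the distance to matrices of low rank.
\<close>

lemma rank_ge_dim_if_bounded_below:
  fixes X Y :: "real^'n^'m"
  assumes V: "subspace V" and below: "\<And>v. v \<in> V \<Longrightarrow> \<mu> * norm v \<le> norm (X *v v)"
    and close: "norm (X - Y) < \<mu>"
  shows "dim V \<le> rank Y"
proof -
  have "v = 0" if v: "v \<in> V" "Y *v v = 0" for v
  proof (rule ccontr)
    assume "v \<noteq> 0"
    have "\<mu> * norm v \<le> norm ((X - Y) *v v)"
      using below[OF v(1)] v(2) by (simp add: matrix_vector_mult_diff_rdistrib)
    also have "\<dots> \<le> norm (X - Y) * norm v"
      by (rule norm_matrix_vector_mult_le)
    also have "\<dots> < \<mu> * norm v"
      using close \<open>v \<noteq> 0\<close> by simp
    finally show False by simp
  qed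
  then have "inj_on ((*v) Y) V"
    by (subst linear_inj_on_iff_eq_0[OF matrix_vector_mul_linear V]) blast
  then have "dim V = dim ((*v) Y ` V)"
    using V by (metis dim_image_eq matrix_vector_mul_linear span_eq_iff)
  also have "\<dots> \<le> rank Y"
    unfolding rank_dim_range by (rule dim_subset) auto
  finally show ?thesis .
qed

text \<open>
  Every matrix is injective, hence bounded below, on its row space, whose dimension is the rank.
\<close>

lemma closed_rank_le: "closed (rank_le r :: (real^'n^'m) set)"
proof -
  have "\<exists>e>0. \<forall>Y. dist Y X < e \<longrightarrow> Y \<in> - rank_le r" if "X \<in> - rank_le r" for X :: "real^'n^'m"
  proof -
    define V where "V = range (\<lambda>y. transpose X *v y)"
    have V: "subspace V"
      unfolding V_def by (intro linear_subspace_image matrix_vector_mul_linear subspace_UNIV)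
    have "v = 0" if "v \<in> V" "X *v v = 0" for v
    proof -
      obtain y where "v = transpose X *v y"
        using \<open>v \<in> V\<close> by (auto simp: V_def)
      then have "v \<bullet> v = y \<bullet> (X *v v)"
        by (metis dot_lmul_matrix transpose_matrix_vector)
      then show "v = 0" using that(2) by simp
    qed
    then obtain \<mu> where \<mu>: "\<mu> > 0" "\<And>v. v \<in> V \<Longrightarrow> \<mu> * norm v \<le> norm (X *v v)"
      using injective_imp_isometric[OF closed_subspace[OF V] V, of "(*v) X"] by blast
    have "dim V = rank X"
      unfolding V_def rank_dim_range[symmetric] by (rule rank_transpose)
    then have "Y \<in> - rank_le r" if "dist Y X < \<mu>" for Y
      using rank_ge_dim_if_bounded_below[OF V \<mu>(2), of Y] that \<open>X \<in> - rank_le r\<close>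
      by (simp add: rank_le_def dist_norm norm_minus_commute)
    then show ?thesis using \<mu>(1) by blast
  qed
  then show ?thesis
    unfolding closed_def open_dist by blast
qed

text \<open>
  A nonzero entry of \<open>Z\<close>, with all the others replaced by zero, is such a matrix.
\<close>

lemma exists_rank_one_positive_inner:
  fixes Z :: "real^'n^'m"
  assumes "Z \<noteq> 0"
  obtains W :: "real^'n^'m" where "rank W \<le> 1" "0 < Z \<bullet> W"
proof -
  obtain i j where ij: "Z $ i $ j \<noteq> 0"
    using assms by (metis vec_eq_iff zero_index)
  define W where "W = block {i} {j} Z"
  have "Z \<bullet> W = (\<Sum>a\<in>UNIV. \<Sum>b\<in>UNIV. if a = i then if b = j then (Z $ i $ j)\<^sup>2 else 0 else 0)"
    unfolding W_def block_def inner_vec_def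
    by (intro sum.cong refl) (auto simp: power2_eq_square)
  also have "\<dots> = (\<Sum>a\<in>UNIV. if a = i then (Z $ i $ j)\<^sup>2 else 0)"
    by (intro sum.cong refl) simp
  also have "\<dots> = (Z $ i $ j)\<^sup>2"
    by simp
  finally have "0 < Z \<bullet> W"
    using ij by simp
  moreover have "rank W \<le> 1"
  proof -
    have "W *v x \<in> span {axis i 1}" for x
    proof -
      have "W *v x = (Z $ i $ j * x $ j) *\<^sub>R axis i 1"
      proof -
        have "(W *v x) $ a = (\<Sum>b\<in>UNIV. if b = j then (if a = i then Z $ i $ j * x $ j else 0) else 0)"
          for a
          unfolding W_def block_def matrix_vector_mult_def by (auto intro!: sum.neutral) (subst sum.cong[OF refl, where h = "\<lambda>b. if b = j then Z $ i $ j * x $ j else 0"], auto)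
        then show ?thesis
          by (simp add: vec_eq_iff axis_def)
      qed
      then show ?thesis by (simp add: span_base span_scale)
    qed
    then have "rank W \<le> dim (span {axis i (1::real)} :: (real^'m) set)"
      unfolding rank_dim_range by (intro dim_subset) auto
    also have "\<dots> \<le> 1"
      using dim_le_card[of "span {axis i (1::real)}" "{axis i (1::real)}"] by simp
    finally show ?thesis .
  qed
  ultimately show ?thesis using that by blast
qed

section \<open>Metric projections onto cones and onto matrices of bounded rank\<close>

lemma metric_projection_iff:
  "Y \<in> metric_projection S Z \<longleftrightarrow> Y \<in> S \<and> (\<forall>W\<in>S. dist Z Y \<le> dist Z W)"
  unfolding metric_projection_def is_arg_min_linorder by blast

lemma metric_projection_nonempty:
  fixes Z :: "'a::heine_borel"
  assumes "closed S" "S \<noteq> {}"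
  shows "metric_projection S Z \<noteq> {}"
proof -
  obtain Y where "Y \<in> S" "\<And>W. W \<in> S \<Longrightarrow> dist Z Y \<le> dist Z W"
    using distance_attains_inf[OF assms, of Z] by metis
  then have "Y \<in> metric_projection S Z"
    by (simp add: metric_projection_iff)
  then show ?thesis by blast
qed

text \<open>
  The step \<open>t\<close> is the one that makes \<open>t *\<^sub>R W\<close> the closest point to \<open>Z\<close> on the line through \<open>W\<close>.
\<close>

lemma step_towards_positive_inner:
  fixes Z W :: "'a::real_inner"
  assumes "0 < Z \<bullet> W"
  obtains t where "0 < t" "(norm (Z - t *\<^sub>R W))\<^sup>2 = (norm Z)\<^sup>2 - (Z \<bullet> W)\<^sup>2 / (norm W)\<^sup>2"
proof
  have W: "0 < W \<bullet> W"
    using assms by (metis inner_gt_zero_iff inner_zero_right less_irrefl)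
  define t where "t = (Z \<bullet> W) / (W \<bullet> W)"
  show "0 < (Z \<bullet> W) / (W \<bullet> W)" using assms W by simp
  show "(norm (Z - ((Z \<bullet> W) / (W \<bullet> W)) *\<^sub>R W))\<^sup>2 = (norm Z)\<^sup>2 - (Z \<bullet> W)\<^sup>2 / (norm W)\<^sup>2"
    using W unfolding power2_norm_eq_inner
    by (simp add: inner_diff_left inner_diff_right inner_commute field_simps power2_eq_square)
qed

text \<open>
  Along the ray through its projection \<open>G\<close>, the distance to \<open>Z\<close> is minimal at \<open>G\<close> itself.
\<close>

lemma metric_projection_cone_inner_self:
  fixes Z :: "'a::real_inner"
  assumes cone: "cone K" and G: "G \<in> metric_projection K Z"
  shows "Z \<bullet> G = (norm G)\<^sup>2"
proof -
  define p q where "p = Z \<bullet> G" and "q = G \<bullet> G"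
  have ineq: "2 * t * p - t\<^sup>2 * q \<le> 2 * p - q" if "0 \<le> t" for t
  proof -
    have "norm (Z - G) \<le> norm (Z - t *\<^sub>R G)"
      using G mem_cone[OF cone, of G t] that by (auto simp: metric_projection_iff dist_norm)
    then have "(norm (Z - G))\<^sup>2 \<le> (norm (Z - t *\<^sub>R G))\<^sup>2"
      by simp
    then show ?thesis
      unfolding p_def q_def power2_norm_eq_inner
      by (simp add: inner_diff_left inner_diff_right inner_commute[of G Z] power2_eq_square
          right_diff_distrib left_diff_distrib)
  qed
  have "p = q"
  proof (cases "q = 0")
    case True
    then show ?thesis by (simp add: p_def q_def)
  next
    case False
    then have q: "q > 0" by (simp add: q_def)
    \<comment> \<open>The minimiser of the quadratic on the ray is at \<open>t = p / q\<close>; it has to coincide with \<open>t = 1\<close>.\<close>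
    have "p \<ge> 0" using ineq[of 0] q by simp
    then have "2 * (p / q) * p - (p / q)\<^sup>2 * q \<le> 2 * p - q"
      using q by (intro ineq) simp
    then have "p\<^sup>2 \<le> (2 * p - q) * q"
      using q by (simp add: field_simps power2_eq_square)
    then have "(p - q)\<^sup>2 \<le> 0"
      by (simp add: power2_eq_square algebra_simps)
    then show ?thesis by simp
  qed
  then show ?thesis by (simp add: p_def q_def power2_norm_eq_inner)
qed

text \<open>
  The norm of the projection onto a cone dominates the length of the projection onto each of its rays.
  This is the source of all lower bounds on the length of search directions.
\<close>

lemma metric_projection_cone_inner_le:
  fixes Z :: "'a::real_inner"
  assumes cone: "cone K" and G: "G \<in> metric_projection K Z"
    and W: "W \<in> K"
  shows "Z \<bullet> W \<le> norm G * norm W"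
proof (cases "0 < Z \<bullet> W")
  case True
  then have W0: "norm W > 0" by auto
  obtain t where t: "0 < t" "(norm (Z - t *\<^sub>R W))\<^sup>2 = (norm Z)\<^sup>2 - (Z \<bullet> W)\<^sup>2 / (norm W)\<^sup>2"
    using step_towards_positive_inner[OF True] .
  have "norm (Z - G) \<le> norm (Z - t *\<^sub>R W)"
    using G mem_cone[OF cone W, of t] t(1) by (auto simp: metric_projection_iff dist_norm)
  then have "(norm (Z - G))\<^sup>2 \<le> (norm (Z - t *\<^sub>R W))\<^sup>2"
    by simp
  moreover have "(norm (Z - G))\<^sup>2 = (norm Z)\<^sup>2 - (norm G)\<^sup>2"
    using metric_projection_cone_inner_self[OF cone G]
    by (simp add: power2_norm_eq_inner inner_diff_left inner_diff_right inner_commute)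
  ultimately have "(Z \<bullet> W)\<^sup>2 \<le> (norm G * norm W)\<^sup>2"
    using t(2) W0 by (simp add: field_simps power_mult_distrib)
  then show ?thesis
    by (rule power2_le_imp_le) simp
next
  case False
  then show ?thesis
    by (meson dual_order.trans linorder_not_less mult_nonneg_nonneg norm_ge_zero)
qed

text \<open>
  A matrix of rank less than \<open>k\<close> leaves room for a rank one correction that brings it closer to \<open>X\<close>.
\<close>

lemma rank_metric_projection_rank_le:
  fixes X :: "real^'n^'m"
  assumes "k < rank X" and Y: "Y \<in> metric_projection (rank_le k) X"
  shows "rank Y = k"
proof (rule ccontr)
  assume "rank Y \<noteq> k"
  with Y have less: "rank Y < k"
    by (simp add: metric_projection_iff rank_le_def)
  with assms(1) have "X - Y \<noteq> 0" by auto
  then obtain W where W: "rank W \<le> 1" "0 < (X - Y) \<bullet> W"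
    by (rule exists_rank_one_positive_inner)
  obtain t where t: "0 < t"
    "(norm (X - Y - t *\<^sub>R W))\<^sup>2 = (norm (X - Y))\<^sup>2 - ((X - Y) \<bullet> W)\<^sup>2 / (norm W)\<^sup>2"
    using step_towards_positive_inner[OF W(2)] .
  have "0 < ((X - Y) \<bullet> W)\<^sup>2 / (norm W)\<^sup>2"
    using W(2) by (intro divide_pos_pos) auto
  then have "(norm (X - Y - t *\<^sub>R W))\<^sup>2 < (norm (X - Y))\<^sup>2"
    using t(2) by linarith
  then have "norm (X - Y - t *\<^sub>R W) < norm (X - Y)"
    by (rule power2_less_imp_less) simp
  moreover have "rank (Y + t *\<^sub>R W) \<le> k"
    using rank_add_le[of Y "t *\<^sub>R W"] rank_scaleR_le[of t W] W(1) less by linarith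
  then have "norm (X - Y) \<le> norm (X - (Y + t *\<^sub>R W))"
    using Y by (auto simp: metric_projection_iff rank_le_def dist_norm)
  ultimately show False
    by (simp add: diff_diff_eq)
qed

text \<open>
  The set of matrices of rank exactly \<open>k\<close> is in general not closed. A matrix of larger rank still has
  projections onto it, because projecting onto the closed set of matrices of rank at most \<open>k\<close> never
  lowers the rank below \<open>k\<close>.
\<close>

lemma metric_projection_rank_eq:
  fixes X :: "real^'n^'m"
  assumes "k < rank X"
  shows "metric_projection (rank_eq k) X = metric_projection (rank_le k) X"
proof -
  have "0 \<in> (rank_le k :: (real^'n^'m) set)" by (simp add: rank_le_def)
  then obtain Y where Y: "Y \<in> metric_projection (rank_le k) X"
    using metric_projection_nonempty[OF closed_rank_le] by blast
  then have "rank Y = k" using assms by (rule rank_metric_projection_rank_le[rotated])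
  then have "metric_projection (rank_eq k) X \<subseteq> metric_projection (rank_le k) X"
    using Y by (force simp: metric_projection_iff rank_le_def rank_eq_def)
  moreover have "metric_projection (rank_le k) X \<subseteq> metric_projection (rank_eq k) X"
    using rank_metric_projection_rank_le[OF assms]
    by (auto simp: metric_projection_iff rank_le_def rank_eq_def)
  ultimately show ?thesis by blast
qed

section \<open>Singular values and distance to matrices of low rank\<close>

text \<open>
  A maximiser \<open>v\<close> of the quadratic form of \<open>S\<close> on the unit sphere of \<open>W\<close> is an eigenvector.
\<close>

lemma self_adjoint_eigenvector:
  fixes S :: "'a::euclidean_space \<Rightarrow> 'a"
  assumes lin: "linear S" and adj: "\<And>x y. S x \<bullet> y = x \<bullet> S y"
    and W: "subspace W" and inv: "S ` W \<subseteq> W" and w: "w \<in> W" "w \<noteq> 0"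
  obtains v a where "v \<in> W" "norm v = 1" "S v = a *\<^sub>R v"
proof -
  let ?K = "W \<inter> sphere 0 1"
  have "compact ?K"
    by (rule closed_Int_compact) (auto intro: closed_subspace W)
  moreover have "(1 / norm w) *\<^sub>R w \<in> ?K"
    using w W by (simp add: subspace_scale)
  then have "?K \<noteq> {}" by blast
  moreover have "continuous_on ?K (\<lambda>v. v \<bullet> S v)"
    using lin by (intro continuous_intros linear_continuous_on linear_conv_bounded_linear[THEN iffD1])
  ultimately obtain v where v: "v \<in> ?K" and max: "\<And>y. y \<in> ?K \<Longrightarrow> y \<bullet> S y \<le> v \<bullet> S v"
    by (metis continuous_attains_sup)
  define a where "a = v \<bullet> S v"
  have quad: "y \<bullet> S y \<le> a * (y \<bullet> y)" if "y \<in> W" for y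
  proof (cases "y = 0")
    case False
    have "((1 / norm y) *\<^sub>R y) \<bullet> S ((1 / norm y) *\<^sub>R y) \<le> a"
      unfolding a_def using that False W by (intro max) (simp add: subspace_scale)
    then show ?thesis
      using False by (simp add: linear_scale[OF lin] field_simps power2_eq_square
          flip: power2_norm_eq_inner)
  qed (simp add: linear_0[OF lin])
  \<comment> \<open>A step \<open>t *\<^sub>R u\<close> along the residual would increase the form, relative to \<open>a\<close> times the squared norm, by \<open>2 * t * (u \<bullet> u)\<close> to first order.\<close>
  define u where "u = S v - a *\<^sub>R v"
  have vW: "v \<in> W" and vv: "v \<bullet> v = 1"
    using v by (auto simp: norm_eq_1)
  have u: "u \<in> W"
    unfolding u_def using vW inv W by (intro subspace_diff subspace_scale) auto
  define C where "C = a * (u \<bullet> u) - u \<bullet> S u"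
  have ineq: "2 * t * (u \<bullet> u) \<le> t\<^sup>2 * C" for t
  proof -
    have le: "(v + t *\<^sub>R u) \<bullet> S (v + t *\<^sub>R u) \<le> a * ((v + t *\<^sub>R u) \<bullet> (v + t *\<^sub>R u))"
      using vW u W by (intro quad) (simp add: subspace_add subspace_scale)
    have lhs: "(v + t *\<^sub>R u) \<bullet> S (v + t *\<^sub>R u) = a + 2 * t * (u \<bullet> S v) + t\<^sup>2 * (u \<bullet> S u)"
      using adj[of u v]
      by (simp add: linear_add[OF lin] linear_scale[OF lin] inner_add_left inner_add_right a_def
          power2_eq_square inner_commute algebra_simps)
    have rhs: "(v + t *\<^sub>R u) \<bullet> (v + t *\<^sub>R u) = 1 + 2 * t * (u \<bullet> v) + t\<^sup>2 * (u \<bullet> u)"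
      using vv by (simp add: inner_add_left inner_add_right power2_eq_square inner_commute)
    have "2 * t * (u \<bullet> S v - a * (u \<bullet> v)) \<le> t\<^sup>2 * C"
      using le unfolding lhs rhs C_def by (simp add: algebra_simps)
    moreover have "u \<bullet> S v - a * (u \<bullet> v) = u \<bullet> u"
      by (simp add: u_def inner_diff_left inner_diff_right vv inner_commute algebra_simps)
    ultimately show ?thesis by simp
  qed
  have "u = 0"
  proof (rule ccontr)
    assume "u \<noteq> 0"
    then have pos: "u \<bullet> u > 0" by simp
    then have C: "C > 0" using ineq[of 1] unfolding one_power2 by linarith
    have "2 * ((u \<bullet> u) / C) * (u \<bullet> u) \<le> ((u \<bullet> u) / C)\<^sup>2 * C"
      by (rule ineq)
    then have "(u \<bullet> u) * (u \<bullet> u) \<le> 0"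
      using C by (simp add: field_simps power2_eq_square)
    then show False
      using mult_pos_pos[OF pos pos] by linarith
  qed
  then have "S v = a *\<^sub>R v" by (simp add: u_def)
  then show ?thesis using that vW v by auto
qed

lemma inner_gram:
  fixes X :: "real^'n^'m"
  shows "((transpose X ** X) *v a) \<bullet> b = (X *v a) \<bullet> (X *v b)"
    and "a \<bullet> ((transpose X ** X) *v b) = (X *v a) \<bullet> (X *v b)"
proof -
  show *: "((transpose X ** X) *v a) \<bullet> b = (X *v a) \<bullet> (X *v b)" for a b
    by (metis dot_lmul_matrix matrix_vector_mul_assoc transpose_matrix_vector)
  show "a \<bullet> ((transpose X ** X) *v b) = (X *v a) \<bullet> (X *v b)"
    using *[of b a] by (simp add: inner_commute)
qed

lemma subspace_sv_eigenspace: "subspace (sv_eigenspace X s)"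
  unfolding sv_eigenspace_def subspace_def
  by (auto simp: matrix_vector_right_distrib scaleR_add_right matrix_vector_mult_scaleR)

lemma norm_sv_eigenspace:
  assumes "v \<in> sv_eigenspace X s" "0 \<le> s" "norm v = 1"
  shows "norm (X *v v) = s"
proof -
  have "(norm (X *v v))\<^sup>2 = v \<bullet> (s\<^sup>2 *\<^sub>R v)"
    using assms(1) inner_gram(2)[where X = X and a = v and b = v] by (simp only: power2_norm_eq_inner sv_eigenspace_def mem_Collect_eq)
  then have "(norm (X *v v))\<^sup>2 = s\<^sup>2"
    using assms(3) by (simp add: norm_eq_1)
  then show ?thesis
    using assms(2) by simp
qed

lemma inner_sv_eigenspace:
  assumes a: "a \<in> sv_eigenspace X s" and b: "b \<in> sv_eigenspace X t" and "0 \<le> s" "0 \<le> t" "s \<noteq> t"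
  shows "a \<bullet> b = 0"
proof -
  have "s\<^sup>2 * (a \<bullet> b) = t\<^sup>2 * (a \<bullet> b)"
    using inner_gram[where X = X and a = a and b = b] a b by (simp only: sv_eigenspace_def mem_Collect_eq inner_scaleR_left inner_scaleR_right)
  moreover have "s\<^sup>2 \<noteq> t\<^sup>2" using assms(3-5) by simp
  ultimately show ?thesis by simp
qed

text \<open>
  Orthonormal bases of the eigenspaces of \<open>transpose X ** X\<close> together span the whole space: otherwise
  the orthogonal complement of their span, being invariant, would contain a further eigenvector. The
  image of a basis vector under \<open>X\<close> has the singular value as its norm, so the list of singular values
  can be read off from the basis without reference to eigenvalues.
\<close>

lemma singular_basis_exists:
  fixes X :: "real^'n^'m"
  obtains B :: "(real^'n) set" where
    "pairwise orthogonal B" "\<And>b. b \<in> B \<Longrightarrow> norm b = 1" "span B = UNIV" "independent B"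
    "pairwise (\<lambda>a b. orthogonal (X *v a) (X *v b)) B"
    "singular_values X = rev (sorted_list_of_multiset (image_mset (\<lambda>b. norm (X *v b)) (mset_set B)))"
proof -
  define E where "E = sv_eigenspace X"
  define T where "T = {s. 0 \<le> s \<and> (\<exists>v\<in>E s. v \<noteq> 0)}"
  have finT: "finite T"
    unfolding T_def E_def by (rule finite_singular_values)
  have "\<exists>B. B \<subseteq> E s \<and> pairwise orthogonal B \<and> (\<forall>b\<in>B. norm b = 1) \<and> card B = dim (E s) \<and> span B = E s" for s
    unfolding E_def by (metis orthonormal_basis_subspace[OF subspace_sv_eigenspace])
  then obtain Bs where Bs: "Bs s \<subseteq> E s" "pairwise orthogonal (Bs s)" "\<And>b. b \<in> Bs s \<Longrightarrow> norm b = 1"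
    "card (Bs s) = dim (E s)" "span (Bs s) = E s" for s
    by metis
  define B where "B = (\<Union>s\<in>T. Bs s)"
  have eig: "(transpose X ** X) *v b = s\<^sup>2 *\<^sub>R b" if "b \<in> Bs s" for b s
    using that Bs(1)[of s] by (auto simp only: E_def sv_eigenspace_def)
  have sigma: "norm (X *v b) = s" if "b \<in> Bs s" "s \<in> T" for b s
    using that Bs(1)[of s] Bs(3) by (intro norm_sv_eigenspace) (auto simp: E_def T_def)
  have orth: "a \<bullet> b = 0" if ab: "a \<in> B" "b \<in> B" "a \<noteq> b" for a b
  proof -
    obtain s t where st: "s \<in> T" "a \<in> Bs s" "t \<in> T" "b \<in> Bs t"
      using ab unfolding B_def by blast
    show ?thesis
    proof (cases "s = t")
      case True
      then show ?thesis using Bs(2)[of s] st ab(3) by (auto simp: pairwise_def orthogonal_def)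
    next
      case False
      then show ?thesis
        using inner_sv_eigenspace[where X = X and a = a and b = b and s = s and t = t]
            st Bs(1)[of s] Bs(1)[of t] by (simp add: E_def T_def subset_iff)
    qed
  qed
  have pw: "pairwise orthogonal B"
    using orth by (simp add: pairwise_def orthogonal_def)
  have norm1: "norm b = 1" if "b \<in> B" for b
    using that Bs(3) by (auto simp: B_def)
  have ind: "independent B"
    using pw norm1 by (intro pairwise_orthogonal_independent) force+
  have pwX: "pairwise (\<lambda>a b. orthogonal (X *v a) (X *v b)) B"
  proof (rule pairwiseI)
    fix a b assume ab: "a \<in> B" "b \<in> B" "a \<noteq> b"
    then obtain s where "a \<in> Bs s" unfolding B_def by blast
    then have "(X *v a) \<bullet> (X *v b) = s\<^sup>2 * (a \<bullet> b)"
      using inner_gram(1)[where X = X and a = a and b = b] by (simp only: eig inner_scaleR_left)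
    then show "orthogonal (X *v a) (X *v b)"
      using orth[OF ab] by (simp add: orthogonal_def)
  qed
  have span: "span B = UNIV"
  proof (rule ccontr)
    assume "span B \<noteq> UNIV"
    then have "dim B < DIM(real^'n)"
      by (metis dim_eq_full dim_subset_UNIV le_neq_implies_less)
    then obtain w where w: "w \<noteq> 0" "\<And>y. y \<in> span B \<Longrightarrow> orthogonal w y"
      by (rule orthogonal_to_subspace_exists) auto
    define W where "W = {y. \<forall>b\<in>B. b \<bullet> y = 0}"
    have "w \<in> W"
      using w(2) by (auto simp: W_def span_base orthogonal_def inner_commute)
    moreover have "subspace W"
      by (auto simp: W_def subspace_def inner_add_right)
    moreover have "(*v) (transpose X ** X) ` W \<subseteq> W"
    proof clarify
      fix y assume y: "y \<in> W"
      have "b \<bullet> ((transpose X ** X) *v y) = 0" if b: "b \<in> B" for b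
      proof -
        obtain s where "b \<in> Bs s" using b unfolding B_def by blast
        then have "b \<bullet> ((transpose X ** X) *v y) = s\<^sup>2 * (b \<bullet> y)"
          by (simp only: inner_gram(2) inner_gram(1)[symmetric] eig inner_scaleR_left)
        then show ?thesis using y b by (simp add: W_def)
      qed
      then show "(transpose X ** X) *v y \<in> W" unfolding W_def by (intro CollectI ballI)
    qed
    ultimately obtain v a where v: "v \<in> W" "norm v = 1" "(transpose X ** X) *v v = a *\<^sub>R v"
      using w(1) self_adjoint_eigenvector[of "(*v) (transpose X ** X)" W w]
      by (smt (verit) inner_gram matrix_vector_mul_linear)
    have "a = v \<bullet> ((transpose X ** X) *v v)"
      using v(2,3) by (simp add: norm_eq_1)
    then have "a = (norm (X *v v))\<^sup>2"
      by (simp only: inner_gram power2_norm_eq_inner)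
    then have vE: "v \<in> E (norm (X *v v))"
      using v(3) by (simp only: E_def sv_eigenspace_def mem_Collect_eq)
    then have "norm (X *v v) \<in> T"
      using v(2) unfolding T_def by (intro CollectI conjI bexI[of _ v]) auto
    then have "v \<in> span B"
      using vE span_mono[of "Bs (norm (X *v v))" B] unfolding Bs(5) by (auto simp: B_def)
    moreover have "y \<bullet> v = 0" if "y \<in> span B" for y
      using that
    proof (induction rule: span_induct_alt)
      case (step c b y)
      then show ?case using v(1) by (simp add: inner_add_left W_def)
    qed simp
    ultimately have "v \<bullet> v = 0" by blast
    then show False using v(2) by simp
  qed
  have finB: "finite B" using ind by (rule independent_imp_finite)
  have "image_mset (\<lambda>b. norm (X *v b)) (mset_set B) = (\<Sum>s\<in>T. replicate_mset (dim (E s)) s)"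
  proof (rule multiset_eqI)
    fix t
    have "{b \<in> B. norm (X *v b) = t} = (if t \<in> T then Bs t else {})"
      using sigma by (auto simp: B_def)
    moreover have "count (image_mset (\<lambda>b. norm (X *v b)) (mset_set B)) t = card {b \<in> B. norm (X *v b) = t}"
      using finB by (simp add: count_image_mset' Collect_conj_eq Int_commute eq_commute)
    moreover have "count (\<Sum>s\<in>T. replicate_mset (dim (E s)) s) t = (if t \<in> T then dim (E t) else 0)"
      using finT by (simp add: count_sum)
    ultimately show "count (image_mset (\<lambda>b. norm (X *v b)) (mset_set B)) t
      = count (\<Sum>s\<in>T. replicate_mset (dim (E s)) s) t"
      by (simp add: Bs(4))
  qed
  then have "singular_values X = rev (sorted_list_of_multiset (image_mset (\<lambda>b. norm (X *v b)) (mset_set B)))"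
    by (simp add: singular_values_def T_def E_def)
  with that pw norm1 span ind pwX show ?thesis by blast
qed

text \<open>
  The entry at index \<open>k - 1\<close> of a descending list is characterised by counting larger entries; this
  avoids any further reasoning about sorting.
\<close>

lemma nth_descending_count:
  fixes M :: "'a::linorder multiset"
  assumes "0 < k" "k \<le> size M"
  defines "x \<equiv> rev (sorted_list_of_multiset M) ! (k - 1)"
  shows "k \<le> size {#y \<in># M. x \<le> y#}" and "size {#y \<in># M. x < y#} < k"
proof -
  define l where "l = rev (sorted_list_of_multiset M)"
  have M: "M = mset l" by (simp add: l_def)
  have len: "length l = size M" by (simp add: M)
  have desc: "l ! j \<le> l ! i" if "i \<le> j" "j < length l" for i j
    using sorted_rev_nth_mono[of l i j] that by (simp add: l_def)
  have size: "size {#y \<in># M. P y#} = card {i. i < length l \<and> P (l ! i)}" for P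
    unfolding M by (simp add: length_filter_conv_card flip: mset_filter)
  have x: "x = l ! (k - 1)" by (simp add: x_def l_def)
  have "{..<k} \<subseteq> {i. i < length l \<and> x \<le> l ! i}"
    using assms(1,2) len by (auto simp: x intro!: desc)
  then have "card {..<k} \<le> size {#y \<in># M. x \<le> y#}"
    unfolding size by (intro card_mono) auto
  then show "k \<le> size {#y \<in># M. x \<le> y#}" by simp
  have "i < k - 1" if "i < length l" "x < l ! i" for i
    using desc[of "k - 1" i] that unfolding x by (meson leD leI)
  then have "{i. i < length l \<and> x < l ! i} \<subseteq> {..<k - 1}"
    by auto
  then have "size {#y \<in># M. x < y#} \<le> card {..<k - 1}"
    unfolding size by (intro card_mono) auto
  then show "size {#y \<in># M. x < y#} < k"
    using assms(1) by simp
qed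

lemma singular_value_count:
  fixes X :: "real^'n^'m"
  assumes k: "0 < k" "k \<le> CARD('n)"
  obtains B :: "(real^'n) set" where
    "pairwise orthogonal B" "\<And>b. b \<in> B \<Longrightarrow> norm b = 1" "span B = UNIV" "independent B"
    "pairwise (\<lambda>a b. orthogonal (X *v a) (X *v b)) B"
    "k \<le> card {b \<in> B. singular_value k X \<le> norm (X *v b)}"
    "card {b \<in> B. singular_value k X < norm (X *v b)} < k"
proof -
  obtain B :: "(real^'n) set" where B:
    "pairwise orthogonal B" "\<And>b. b \<in> B \<Longrightarrow> norm b = 1" "span B = UNIV" "independent B"
    "pairwise (\<lambda>a b. orthogonal (X *v a) (X *v b)) B"
    "singular_values X = rev (sorted_list_of_multiset (image_mset (\<lambda>b. norm (X *v b)) (mset_set B)))"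
    by (rule singular_basis_exists[of X]) blast
  have fin: "finite B" using B(4) by (rule independent_imp_finite)
  have "dim (span B) = card B"
    using B(4) by (simp add: dim_eq_card_independent)
  then have "card B = CARD('n)" by (simp add: B(3))
  then have "k \<le> size (image_mset (\<lambda>b. norm (X *v b)) (mset_set B))"
    using k by simp
  note cnt = nth_descending_count[OF k(1) this, folded B(6) singular_value_def]
  have "size {#y \<in># image_mset (\<lambda>b. norm (X *v b)) (mset_set B). P y#} = card {b \<in> B. P (norm (X *v b))}" for P
    using fin by (simp add: filter_mset_image_mset)
  then show ?thesis
    using that B(1-5) cnt by simp
qed

text \<open>
  On the span of the right singular vectors with singular value at least \<open>\<sigma>\<^sub>k(X)\<close>, \<open>X\<close> shrinks vectors at
  most by the factor \<open>\<sigma>\<^sub>k(X)\<close>. This span has dimension at least \<open>k\<close>, so a matrix of rank less than \<open>k\<close>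
  cannot be injective on it.
\<close>

lemma singular_value_le_dist_rank_lt:
  fixes X Y :: "real^'n^'m"
  assumes k: "0 < k" "k \<le> CARD('n)" and "rank Y < k"
  shows "singular_value k X \<le> norm (X - Y)"
proof (rule ccontr)
  assume less: "\<not> singular_value k X \<le> norm (X - Y)"
  define \<sigma> where "\<sigma> = singular_value k X"
  obtain B :: "(real^'n) set" where B:
    "pairwise orthogonal B" "\<And>b. b \<in> B \<Longrightarrow> norm b = 1" "independent B"
    "pairwise (\<lambda>a b. orthogonal (X *v a) (X *v b)) B"
    "k \<le> card {b \<in> B. \<sigma> \<le> norm (X *v b)}"
    unfolding \<sigma>_def by (rule singular_value_count[OF k, of X]) blast
  define C where "C = {b \<in> B. \<sigma> \<le> norm (X *v b)}"
  have fin: "finite C"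
    using independent_imp_finite[OF B(3)] by (simp add: C_def)
  have "\<sigma> \<ge> 0"
    using less norm_ge_zero[of "X - Y"] unfolding \<sigma>_def by linarith
  have "\<sigma> * norm v \<le> norm (X *v v)" if "v \<in> span C" for v
  proof -
    obtain u where v: "v = (\<Sum>b\<in>C. u b *\<^sub>R b)"
      using \<open>v \<in> span C\<close> span_finite[OF fin] by auto
    have "(norm v)\<^sup>2 = (\<Sum>b\<in>C. (u b)\<^sup>2)"
    proof -
      have "(norm v)\<^sup>2 = (\<Sum>b\<in>C. (norm (u b *\<^sub>R b))\<^sup>2)"
        unfolding v using B(1) by (intro norm_sum_Pythagorean fin)
          (auto simp: pairwise_def C_def orthogonal_clauses)
      then show ?thesis using B(2) by (simp add: C_def)
    qed
    then have "(\<sigma> * norm v)\<^sup>2 = (\<Sum>b\<in>C. (u b)\<^sup>2 * \<sigma>\<^sup>2)"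
      by (simp add: power_mult_distrib sum_distrib_left mult.commute)
    also have "\<dots> \<le> (\<Sum>b\<in>C. (u b)\<^sup>2 * (norm (X *v b))\<^sup>2)"
      using \<open>\<sigma> \<ge> 0\<close> by (intro sum_mono mult_left_mono power_mono) (auto simp: C_def)
    also have "\<dots> = (\<Sum>b\<in>C. (norm (u b *\<^sub>R (X *v b)))\<^sup>2)"
      by (simp add: power_mult_distrib)
    also have "\<dots> = (norm (\<Sum>b\<in>C. u b *\<^sub>R (X *v b)))\<^sup>2"
      using B(4) by (intro norm_sum_Pythagorean[symmetric] fin)
        (auto simp: pairwise_def C_def orthogonal_clauses)
    also have "(\<Sum>b\<in>C. u b *\<^sub>R (X *v b)) = X *v v"
      unfolding v by (simp add: linear_sum[OF matrix_vector_mul_linear] matrix_vector_mult_scaleR)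
    finally show ?thesis by (rule power2_le_imp_le) simp
  qed
  then have "dim (span C) \<le> rank Y"
    using less by (intro rank_ge_dim_if_bounded_below[where \<mu> = \<sigma> and X = X]) (auto simp: \<sigma>_def)
  moreover have "dim (span C) = card C"
    using B(3) by (simp add: C_def dim_eq_card_independent independent_mono)
  ultimately show False
    using B(5) \<open>rank Y < k\<close> by (simp add: C_def)
qed

text \<open>
  The range of \<open>X\<close> is spanned by the images of the singular vectors with nonzero singular value.
\<close>

lemma singular_value_pos:
  fixes X :: "real^'n^'m"
  assumes "0 < k" "k \<le> rank X"
  shows "0 < singular_value k X"
proof (rule ccontr)
  assume neg: "\<not> 0 < singular_value k X"
  have "k \<le> CARD('n)"
    using assms(2) rank_bound[of X] by simp
  then obtain B :: "(real^'n) set" where B: "span B = UNIV" "independent B"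
    "card {b \<in> B. singular_value k X < norm (X *v b)} < k"
    by (rule singular_value_count[OF assms(1), of X]) blast
  let ?C = "{b \<in> B. singular_value k X < norm (X *v b)}"
  have fin: "finite ?C"
    using independent_imp_finite[OF B(2)] by simp
  have "X *v b \<in> span ((*v) X ` ?C)" if "b \<in> B" for b
  proof (cases "X *v b = 0")
    case False
    then have "b \<in> ?C"
      using that neg zero_less_norm_iff[of "X *v b"] by (simp add: not_less del: zero_less_norm_iff)
    then show ?thesis by (intro span_base) blast
  qed (simp add: span_zero)
  then have "span ((*v) X ` B) \<subseteq> span ((*v) X ` ?C)"
    by (intro span_minimal) auto
  moreover have "span ((*v) X ` B) = range ((*v) X)"
    by (metis B(1) linear_span_image matrix_vector_mul_linear)
  ultimately have "rank X \<le> card ((*v) X ` ?C)"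
    unfolding rank_dim_range using fin by (intro dim_le_card) auto
  also have "\<dots> \<le> card ?C"
    using fin by (rule card_image_le)
  finally show False
    using B(3) assms(2) by simp
qed

corollary singular_value_pos_iff:
  fixes X :: "real^'n^'m"
  assumes "0 < k" "k \<le> CARD('n)"
  shows "0 < singular_value k X \<longleftrightarrow> k \<le> rank X"
  using singular_value_pos[of k X] singular_value_le_dist_rank_lt[of k X X] assms by fastforce

section \<open>Orthogonal projectors\<close>

lemma bounded_bilinear_matrix_mult:
  "bounded_bilinear ((**) :: real^'n^'m \<Rightarrow> real^'k^'n \<Rightarrow> real^'k^'m)"
proof -
  have "bilinear ((**) :: real^'n^'m \<Rightarrow> real^'k^'n \<Rightarrow> real^'k^'m)"
    unfolding bilinear_def linear_iff
    by (auto simp: matrix_matrix_mult_def vec_eq_iff sum.distrib sum_distrib_left algebra_simps)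
  then show ?thesis
    by (simp add: bilinear_conv_bounded_bilinear)
qed

interpretation matrix_mult: bounded_bilinear "(**) :: real^'n^'m \<Rightarrow> real^'k^'n \<Rightarrow> real^'k^'m"
  by (rule bounded_bilinear_matrix_mult)

definition orthogonal_projector :: "real^'k^'k \<Rightarrow> (real^'k) set \<Rightarrow> bool" where
  "orthogonal_projector E S \<longleftrightarrow>
     transpose E = E \<and> (\<forall>x. E *v x \<in> S) \<and> (\<forall>x\<in>S. E *v x = x)"

text \<open>
  Uniqueness is what makes the cones independent of the choice of the adapted bases.
\<close>

lemma orthogonal_projector_unique:
  assumes "orthogonal_projector E S" "orthogonal_projector F S"
  shows "E = F"
proof -
  have EF: "E ** F = F" and FE: "F ** E = E"
    using assms unfolding orthogonal_projector_def matrix_eq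
    by (simp_all flip: matrix_vector_mul_assoc)
  have "E = F ** E" by (simp add: FE)
  also have "\<dots> = transpose (E ** F)"
    using assms by (simp add: matrix_transpose_mul orthogonal_projector_def)
  also have "\<dots> = F"
    using assms by (simp add: EF orthogonal_projector_def)
  finally show ?thesis .
qed

text \<open>
  Cutting out a block is multiplication by diagonal projectors, so that conjugation by orthogonal
  matrices turns it into multiplication by orthogonal projectors.
\<close>

lemma block_eq_mult:
  fixes M :: "real^'n^'m"
  shows "block I J M = block I I (mat 1) ** M ** block J J (mat 1)"
proof -
  have left: "(block I I (mat 1) ** N) $ i $ j = (if i \<in> I then N $ i $ j else 0)"
    for N :: "real^'c^'m" and i j
  proof -
    have "(block I I (mat 1) ** N) $ i $ j
        = (\<Sum>k\<in>UNIV. if k = i then if i \<in> I then N $ i $ j else 0 else 0)"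
      unfolding matrix_matrix_mult_def block_def mat_def vec_lambda_beta by (rule sum.cong) auto
    then show ?thesis by simp
  qed
  have right: "(N ** block J J (mat 1)) $ i $ j = (if j \<in> J then N $ i $ j else 0)"
    for N :: "real^'n^'m" and i j
  proof -
    have "(N ** block J J (mat 1)) $ i $ j
        = (\<Sum>k\<in>UNIV. if k = j then if j \<in> J then N $ i $ j else 0 else 0)"
      unfolding matrix_matrix_mult_def block_def mat_def vec_lambda_beta by (rule sum.cong) auto
    then show ?thesis by simp
  qed
  show ?thesis
    by (simp add: vec_eq_iff right left) (simp add: block_def)
qed

lemma orthogonal_projector_columns:
  assumes P: "orthogonal_matrix P"
  shows "orthogonal_projector (P ** block I I (mat 1) ** transpose P) (span ((\<lambda>i. column i P) ` I))"
proof -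
  let ?D = "block I I (mat 1) :: real^'a^'a" and ?E = "P ** block I I (mat 1) ** transpose P"
  have D: "?D *v y = (\<chi> i. if i \<in> I then y $ i else 0)" for y
  proof -
    have "(?D *v y) $ i = (\<Sum>k\<in>UNIV. if k = i then if i \<in> I then y $ i else 0 else 0)" for i
      unfolding matrix_vector_mult_def block_def mat_def vec_lambda_beta by (rule sum.cong) auto
    then show ?thesis by (simp add: vec_eq_iff)
  qed
  have E: "?E *v x = P *v (?D *v (transpose P *v x))" for x
    by (simp only: matrix_vector_mul_assoc matrix_mul_assoc)
  have "transpose ?D = ?D"
    by (auto simp: vec_eq_iff transpose_def block_def mat_def)
  then have "transpose ?E = ?E"
    by (simp add: matrix_transpose_mul matrix_mul_assoc)
  moreover have "?E *v x \<in> span ((\<lambda>i. column i P) ` I)" for x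
  proof -
    have "?E *v x = (\<Sum>i\<in>UNIV. (?D *v (transpose P *v x)) $ i *s column i P)"
      unfolding E by (rule matrix_mult_sum)
    also have "\<dots> \<in> span ((\<lambda>i. column i P) ` I)"
      by (intro span_sum) (auto simp: D scalar_mult_eq_scaleR span_zero intro!: span_scale intro: span_base)
    finally show ?thesis .
  qed
  moreover have "?E *v x = x" if "x \<in> span ((\<lambda>i. column i P) ` I)" for x
    using that
  proof (induction rule: span_induct_alt)
    case (step c b y)
    then obtain i where i: "i \<in> I" "b = P *v axis i 1"
      by (auto simp: matrix_vector_mult_basis)
    have "transpose P *v b = axis i 1"
      using P by (simp only: i(2) matrix_vector_mul_assoc orthogonal_matrix_def matrix_vector_mul_lid)
    then have "?E *v b = b"
      unfolding E using i by (simp add: D) (intro arg_cong[where f = "(*v) P"], auto simp: vec_eq_iff axis_def)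
    then show ?case
      using step.IH by (simp add: matrix_vector_right_distrib matrix_vector_mult_scaleR)
  qed simp
  ultimately show ?thesis
    unfolding orthogonal_projector_def by blast
qed

lemma orthogonal_matrix_complement:
  assumes P: "orthogonal_matrix P"
  shows "mat 1 - P ** block I I (mat 1) ** transpose P = P ** block (- I) (- I) (mat 1) ** transpose P"
proof -
  have "block (- I) (- I) (mat 1) = mat 1 - (block I I (mat 1) :: real^'a^'a)"
    by (auto simp: vec_eq_iff block_def mat_def)
  then show ?thesis
    using P by (simp add: matrix_mult.diff_left matrix_mult.diff_right orthogonal_matrix_def)
qed

text \<open>
  The columns of \<open>P\<close> enumerate an orthonormal basis of \<open>S\<close> and one of its orthogonal complement.
\<close>

lemma adapted_columns_exist:
  fixes S :: "(real^'k) set"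
  assumes S: "subspace S"
  obtains P :: "real^'k^'k" and I where
    "orthogonal_matrix P" "card I = dim S" "span ((\<lambda>i. column i P) ` I) = S"
proof -
  define S' where "S' = {y \<in> UNIV. \<forall>x\<in>S. orthogonal x y}"
  have "subspace S'"
    by (auto simp: S'_def subspace_def orthogonal_clauses)
  have dims: "dim S' + dim S = CARD('k)"
    using dim_subspace_orthogonal_to_vectors[OF S subspace_UNIV] by (simp add: S'_def)
  obtain B where B: "B \<subseteq> S" "pairwise orthogonal B" "\<And>x. x \<in> B \<Longrightarrow> norm x = 1"
    "independent B" "card B = dim S" "span B = S"
    using orthonormal_basis_subspace[OF S] by metis
  obtain C where C: "C \<subseteq> S'" "pairwise orthogonal C" "\<And>x. x \<in> C \<Longrightarrow> norm x = 1"
    "independent C" "card C = dim S'" "span C = S'"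
    using orthonormal_basis_subspace[OF \<open>subspace S'\<close>] by metis
  have BC: "orthogonal b c" "orthogonal c b" if "b \<in> B" "c \<in> C" for b c
  proof -
    show "orthogonal b c" using that B(1) C(1) by (auto simp: S'_def)
    then show "orthogonal c b" by (simp add: orthogonal_commute)
  qed
  have "B \<inter> C = {}"
    using BC B(3) by (metis disjoint_iff norm_zero orthogonal_self zero_neq_one)
  then have "card (B \<union> C) = CARD('k)"
    using dims B(4,5) C(4,5) by (simp add: card_Un_disjoint independent_imp_finite)
  then obtain h where h: "bij_betw h (UNIV :: 'k set) (B \<union> C)"
    using finite_same_card_bij[of "UNIV :: 'k set" "B \<union> C"] B(4) C(4) independent_imp_finite by auto
  define P :: "real^'k^'k" where "P = (\<chi> i j. h j $ i)"
  have col: "column j P = h j" for j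
    by (simp add: P_def column_def vec_eq_iff)
  have hBC: "h j \<in> B \<union> C" for j
    using h by (auto simp: bij_betw_def)
  have inj: "inj h" using h by (simp add: bij_betw_def)
  have "pairwise orthogonal (B \<union> C)"
    using B(2) C(2) BC by (auto simp: pairwise_def)
  then have "orthogonal_matrix P"
    unfolding orthogonal_matrix_orthonormal_columns col
    using hBC B(3) C(3) inj by (metis UnE injD pairwiseD)
  moreover have img: "h ` (h -` B) = B"
    using h by (auto simp: bij_betw_def)
  then have "card (h -` B) = dim S"
    by (metis B(5) card_image inj inj_on_subset subset_UNIV)
  moreover have "span ((\<lambda>i. column i P) ` (h -` B)) = S"
    using B(6) img by (simp add: col)
  ultimately show ?thesis by (rule that)
qed

definition range_projector :: "real^'n^'m \<Rightarrow> real^'m^'m" where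
  "range_projector X = (THE E. orthogonal_projector E (range ((*v) X)))"

lemma range_projector_eqI:
  "orthogonal_projector E (range ((*v) X)) \<Longrightarrow> range_projector X = E"
  unfolding range_projector_def using orthogonal_projector_unique by blast

lemma subspace_range_matrix: "subspace (range ((*v) (X :: real^'n^'m)))"
  by (intro linear_subspace_image matrix_vector_mul_linear subspace_UNIV)

lemma orthogonal_projector_range_projector:
  fixes X :: "real^'n^'m"
  shows "orthogonal_projector (range_projector X) (range ((*v) X))"
proof -
  obtain P :: "real^'m^'m" and I where "orthogonal_matrix P"
    "span ((\<lambda>i. column i P) ` I) = range ((*v) X)"
    using adapted_columns_exist[OF subspace_range_matrix[of X]] by metis
  with orthogonal_projector_columns[of P I] show ?thesis
    using range_projector_eqI by metis
qed

lemma range_projector_mult: "range_projector X ** X = X"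
  using orthogonal_projector_range_projector[of X]
  unfolding orthogonal_projector_def matrix_eq by (simp flip: matrix_vector_mul_assoc)

lemma mult_range_projector_transpose: "X ** range_projector (transpose X) = X"
proof -
  have "transpose (X ** range_projector (transpose X)) = transpose X"
    using orthogonal_projector_range_projector[of "transpose X"]
    by (simp add: matrix_transpose_mul range_projector_mult orthogonal_projector_def)
  then show ?thesis by (metis transpose_transpose)
qed

lemma range_projector_idem: "range_projector X ** range_projector X = range_projector X"
proof -
  have "range_projector X *v (range_projector X *v x) = range_projector X *v x" for x
    using orthogonal_projector_range_projector[of X] unfolding orthogonal_projector_def by blast
  then show ?thesis
    by (simp add: matrix_eq flip: matrix_vector_mul_assoc)
qed

lemma rank_range_projector: "rank (range_projector X) = rank X"
proof -
  have "range ((*v) (range_projector X)) = range ((*v) X)"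
    using orthogonal_projector_range_projector[of X] unfolding orthogonal_projector_def
    by (smt (verit, best) image_iff image_subset_iff rangeI subsetI subset_antisym)
  then show ?thesis by (simp add: rank_dim_range)
qed

lemma range_projector_0: "range_projector 0 = 0"
  by (rule range_projector_eqI)
    (auto simp: orthogonal_projector_def transpose_def vec_eq_iff image_iff)

text \<open>
  The columns of the projector lie in the range of \<open>X\<close>.
\<close>

lemma range_projector_factor:
  fixes X :: "real^'n^'m"
  obtains K where "range_projector X = X ** K"
proof -
  have "\<forall>j. \<exists>y. range_projector X *v axis j 1 = X *v y"
    using orthogonal_projector_range_projector[of X] unfolding orthogonal_projector_def by blast
  then obtain y where y: "\<And>j. range_projector X *v axis j 1 = X *v y j" by metis
  define K :: "real^'m^'n" where "K = (\<chi> i j. y j $ i)"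
  have "column j (X ** K) = X *v y j" for j
    by (simp add: vec_eq_iff K_def column_def matrix_matrix_mult_def matrix_vector_mult_def)
  then have "column j (X ** K) = column j (range_projector X)" for j
    by (simp add: y[symmetric] matrix_vector_mult_basis)
  then have "range_projector X = X ** K"
    by (simp add: vec_eq_iff column_def)
  then show ?thesis by (rule that)
qed

section \<open>Tangent cones and restricted tangent cones\<close>

lemma rank_orthogonal_conj:
  fixes M :: "real^'n^'m"
  assumes P: "orthogonal_matrix P" and Q: "orthogonal_matrix Q"
  shows "rank (P ** M ** transpose Q) = rank M"
proof (rule antisym)
  show "rank (P ** M ** transpose Q) \<le> rank M"
    by (meson order_trans rank_mul_le_left rank_mul_le_right)
  have "M = transpose P ** (P ** M ** transpose Q) ** Q"
    using P Q unfolding orthogonal_matrix_def by (metis matrix_mul_assoc matrix_mul_lid matrix_mul_rid)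
  then show "rank M \<le> rank (P ** M ** transpose Q)"
    by (metis order_trans rank_mul_le_left rank_mul_le_right)
qed

lemma adapted_bases_exist:
  fixes X :: "real^'n^'m"
  obtains P I Q J where "adapted_bases X P I Q J"
proof -
  obtain P :: "real^'m^'m" and I where P: "orthogonal_matrix P" "card I = dim (range ((*v) X))"
    "span ((\<lambda>i. column i P) ` I) = range ((*v) X)"
    by (rule adapted_columns_exist[OF subspace_range_matrix[of X]])
  obtain Q :: "real^'n^'n" and J where Q: "orthogonal_matrix Q" "card J = dim (range ((*v) (transpose X)))"
    "span ((\<lambda>i. column i Q) ` J) = range ((*v) (transpose X))"
    by (rule adapted_columns_exist[OF subspace_range_matrix[of "transpose X"]])
  have "adapted_bases X P I Q J"
    unfolding adapted_bases_def using P Q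
    by (simp only: rank_dim_range[symmetric] rank_transpose)
  then show ?thesis by (rule that)
qed

text \<open>
  In adapted bases, passing to a block amounts to multiplying by the projectors onto the column space
  \<open>E\<close> and the row space \<open>F\<close> of \<open>X\<close>, or by their complements.
\<close>

lemma block_adapted_bases:
  fixes X :: "real^'n^'m"
  assumes ad: "adapted_bases X P I Q J"
  defines "E \<equiv> range_projector X" and "F \<equiv> range_projector (transpose X)"
  shows "rank (block (- I) (- J) M) = rank ((mat 1 - E) ** (P ** M ** transpose Q) ** (mat 1 - F))"
    and "block I (- J) M = 0 \<longleftrightarrow> E ** (P ** M ** transpose Q) ** (mat 1 - F) = 0"
    and "block (- I) J M = 0 \<longleftrightarrow> (mat 1 - E) ** (P ** M ** transpose Q) ** F = 0"
proof -
  have P: "orthogonal_matrix P" and Q: "orthogonal_matrix Q"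
    using ad by (auto simp: adapted_bases_def)
  have E: "E = P ** block I I (mat 1) ** transpose P"
    unfolding E_def using ad orthogonal_projector_columns[OF P, of I]
    by (intro range_projector_eqI) (simp only: adapted_bases_def)
  have F: "F = Q ** block J J (mat 1) ** transpose Q"
    unfolding F_def using ad orthogonal_projector_columns[OF Q, of J]
    by (intro range_projector_eqI) (simp only: adapted_bases_def)
  have E': "mat 1 - E = P ** block (- I) (- I) (mat 1) ** transpose P"
    unfolding E by (rule orthogonal_matrix_complement[OF P])
  have F': "mat 1 - F = Q ** block (- J) (- J) (mat 1) ** transpose Q"
    unfolding F by (rule orthogonal_matrix_complement[OF Q])
  have conj: "(P ** block K K (mat 1) ** transpose P) ** (P ** M ** transpose Q) **
        (Q ** block L L (mat 1) ** transpose Q) = P ** block K L M ** transpose Q" for K L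
  proof -
    have "(P ** block K K (mat 1) ** transpose P) ** (P ** M ** transpose Q) **
        (Q ** block L L (mat 1) ** transpose Q)
      = P ** (block K K (mat 1) ** (transpose P ** P) ** M ** (transpose Q ** Q) ** block L L (mat 1)) ** transpose Q"
      by (simp only: matrix_mul_assoc)
    then show ?thesis
      using P Q by (simp add: orthogonal_matrix_def flip: block_eq_mult)
  qed
  have zero: "P ** N ** transpose Q = 0 \<longleftrightarrow> N = 0" for N :: "real^'n^'m"
    using rank_orthogonal_conj[OF P Q, of N] by (metis rank_eq_0)
  show "rank (block (- I) (- J) M) = rank ((mat 1 - E) ** (P ** M ** transpose Q) ** (mat 1 - F))"
    unfolding E' F' conj by (simp add: rank_orthogonal_conj[OF P Q])
  show "block I (- J) M = 0 \<longleftrightarrow> E ** (P ** M ** transpose Q) ** (mat 1 - F) = 0"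
    unfolding E F' conj zero ..
  show "block (- I) J M = 0 \<longleftrightarrow> (mat 1 - E) ** (P ** M ** transpose Q) ** F = 0"
    unfolding E' F conj zero ..
qed

lemma adapted_bases_coords:
  assumes "adapted_bases X P I Q J"
  shows "Z = P ** (transpose P ** Z ** Q) ** transpose Q"
  using assms unfolding adapted_bases_def orthogonal_matrix_def
  by (metis matrix_mul_assoc matrix_mul_lid matrix_mul_rid)

text \<open>
  The description also covers \<open>X = 0\<close>, where both projectors vanish.
\<close>

lemma tangent_cone_iff:
  fixes X :: "real^'n^'m"
  defines "E \<equiv> range_projector X" and "F \<equiv> range_projector (transpose X)"
  shows "Z \<in> tangent_cone r X \<longleftrightarrow> rank ((mat 1 - E) ** Z ** (mat 1 - F)) \<le> r - rank X"
proof (cases "X = 0")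
  case True
  then have "E = 0" "F = 0"
    by (simp_all add: E_def F_def range_projector_0 transpose_def flip: zero_vec_def)
  then show ?thesis
    using True by (simp add: tangent_cone_def rank_le_def)
next
  case False
  obtain P I Q J where ad: "adapted_bases X P I Q J"
    by (rule adapted_bases_exist)
  show ?thesis
  proof
    assume "Z \<in> tangent_cone r X"
    then obtain P M Q I J where "adapted_bases X P I Q J" "Z = P ** M ** transpose Q"
      "rank (block (- I) (- J) M) \<le> r - rank X"
      using False unfolding tangent_cone_def by auto
    then show "rank ((mat 1 - E) ** Z ** (mat 1 - F)) \<le> r - rank X"
      unfolding E_def F_def by (metis block_adapted_bases(1))
  next
    assume "rank ((mat 1 - E) ** Z ** (mat 1 - F)) \<le> r - rank X"
    then have "rank (block (- I) (- J) (transpose P ** Z ** Q)) \<le> r - rank X"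
      unfolding block_adapted_bases(1)[OF ad] E_def F_def
      by (simp flip: adapted_bases_coords[OF ad])
    then show "Z \<in> tangent_cone r X"
      using False ad adapted_bases_coords[OF ad, of Z] unfolding tangent_cone_def
      by (simp only: if_False) (intro CollectI exI conjI)
  qed
qed

lemma restricted_tangent_cone_iff:
  fixes X :: "real^'n^'m"
  defines "E \<equiv> range_projector X" and "F \<equiv> range_projector (transpose X)"
  shows "Z \<in> restricted_tangent_cone r X \<longleftrightarrow>
    rank ((mat 1 - E) ** Z ** (mat 1 - F)) \<le> r - rank X \<and>
    (E ** Z ** (mat 1 - F) = 0 \<or> (mat 1 - E) ** Z ** F = 0)"
proof (cases "X = 0")
  case True
  then have "E = 0" "F = 0"
    by (simp_all add: E_def F_def range_projector_0 transpose_def flip: zero_vec_def)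
  then show ?thesis
    using True by (simp add: restricted_tangent_cone_def rank_le_def)
next
  case False
  obtain P I Q J where ad: "adapted_bases X P I Q J"
    by (rule adapted_bases_exist)
  show ?thesis
  proof
    assume "Z \<in> restricted_tangent_cone r X"
    then obtain P M Q I J where "adapted_bases X P I Q J" "Z = P ** M ** transpose Q"
      "rank (block (- I) (- J) M) \<le> r - rank X" "block I (- J) M = 0 \<or> block (- I) J M = 0"
      using False unfolding restricted_tangent_cone_def by auto
    then show "rank ((mat 1 - E) ** Z ** (mat 1 - F)) \<le> r - rank X \<and>
        (E ** Z ** (mat 1 - F) = 0 \<or> (mat 1 - E) ** Z ** F = 0)"
      unfolding E_def F_def by (metis block_adapted_bases)
  next
    let ?M = "transpose P ** Z ** Q"
    assume "rank ((mat 1 - E) ** Z ** (mat 1 - F)) \<le> r - rank X \<and>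
        (E ** Z ** (mat 1 - F) = 0 \<or> (mat 1 - E) ** Z ** F = 0)"
    then have "rank (block (- I) (- J) ?M) \<le> r - rank X \<and>
        (block I (- J) ?M = 0 \<or> block (- I) J ?M = 0)"
      unfolding block_adapted_bases[OF ad] E_def F_def
      by (simp flip: adapted_bases_coords[OF ad])
    then show "Z \<in> restricted_tangent_cone r X"
      using False ad adapted_bases_coords[OF ad, of Z] unfolding restricted_tangent_cone_def
      by (simp only: if_False) (intro CollectI exI[of _ P] exI[of _ ?M] exI[of _ Q] exI[of _ I] exI[of _ J] conjI, blast+)
  qed
qed


lemma tangent_cone_props:
  fixes X :: "real^'n^'m"
  shows closed_tangent_cone: "closed (tangent_cone r X)"
    and closed_restricted_tangent_cone: "closed (restricted_tangent_cone r X)"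
    and cone_tangent_cone: "cone (tangent_cone r X)"
    and cone_restricted_tangent_cone: "cone (restricted_tangent_cone r X)"
    and zero_in_tangent_cone: "0 \<in> tangent_cone r X"
    and zero_in_restricted_tangent_cone: "0 \<in> restricted_tangent_cone r X"
proof -
  define E F where "E = range_projector X" and "F = range_projector (transpose X)"
  note iffs = tangent_cone_iff[of _ r X, folded E_def F_def]
    restricted_tangent_cone_iff[of _ r X, folded E_def F_def]
  have cont: "continuous_on UNIV (\<lambda>Z. A ** Z ** B)" for A :: "real^'m^'m" and B :: "real^'n^'n"
    by (intro matrix_mult.continuous_on continuous_intros)
  have D: "closed {Z. rank ((mat 1 - E) ** Z ** (mat 1 - F)) \<le> r - rank X}"
    using closed_vimage[OF closed_rank_le cont[of "mat 1 - E" "mat 1 - F"], of "r - rank X"]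
    by (simp add: rank_le_def vimage_def)
  have zero: "closed {Z. A ** Z ** B = 0}" for A :: "real^'m^'m" and B :: "real^'n^'n"
    by (rule closed_Collect_eq[OF cont continuous_on_const])
  have tangent: "tangent_cone r X = {Z. rank ((mat 1 - E) ** Z ** (mat 1 - F)) \<le> r - rank X}"
    using iffs(1) by blast
  show "closed (tangent_cone r X)"
    unfolding tangent using D .
  have "restricted_tangent_cone r X = {Z. rank ((mat 1 - E) ** Z ** (mat 1 - F)) \<le> r - rank X} \<inter>
      ({Z. E ** Z ** (mat 1 - F) = 0} \<union> {Z. (mat 1 - E) ** Z ** F = 0})"
    using iffs(2) by blast
  then show "closed (restricted_tangent_cone r X)"
    using D zero by (simp add: closed_Int closed_Un)
  have rank: "rank ((mat 1 - E) ** (t *\<^sub>R Z) ** (mat 1 - F)) \<le> rank ((mat 1 - E) ** Z ** (mat 1 - F))" for t Z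
    by (simp add: matrix_mult.scaleR_left matrix_mult.scaleR_right rank_scaleR_le)
  show "cone (tangent_cone r X)"
    unfolding cone_def iffs by (intro ballI allI impI) (unfold iffs, rule order_trans[OF rank])
  show "cone (restricted_tangent_cone r X)"
    unfolding cone_def
  proof (intro ballI allI impI)
    fix Z and t :: real assume "Z \<in> restricted_tangent_cone r X"
    then show "t *\<^sub>R Z \<in> restricted_tangent_cone r X"
      using rank[of t Z] unfolding iffs
      by (auto simp: matrix_mult.scaleR_left matrix_mult.scaleR_right)
  qed
  show "0 \<in> tangent_cone r X" "0 \<in> restricted_tangent_cone r X"
    unfolding iffs by (simp_all add: matrix_mult.zero_left matrix_mult.zero_right)
qed

lemma complement_range_projector_mult: "(mat 1 - range_projector X) ** X = 0"
  by (simp add: matrix_mult.diff_left range_projector_mult)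

lemma mult_complement_range_projector: "X ** (mat 1 - range_projector (transpose X)) = 0"
  by (simp add: matrix_mult.diff_right mult_range_projector_transpose)

text \<open>
  This is where the restriction on the off-diagonal blocks is needed. If one of them vanishes, then
  \<open>X + t *\<^sub>R G\<close> is the sum of a matrix whose row space or column space lies in that of \<open>X\<close> and of a matrix
  of rank at most \<open>r - rank X\<close>; every restricted tangent vector thus is a feasible direction.
\<close>

lemma rank_le_add_restricted_tangent_cone:
  fixes X :: "real^'n^'m"
  assumes X: "rank X \<le> r" and G: "G \<in> restricted_tangent_cone r X"
  shows "rank (X + t *\<^sub>R G) \<le> r"
proof -
  define E F where "E = range_projector X" and "F = range_projector (transpose X)"
  define E' F' where "E' = mat 1 - E" and "F' = mat 1 - F"
  have rD: "rank (E' ** G ** F') \<le> r - rank X" and BC: "E ** G ** F' = 0 \<or> E' ** G ** F = 0"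
    using G[unfolded restricted_tangent_cone_iff] by (simp_all add: E_def F_def E'_def F'_def)
  have E'X: "E' ** X = 0" and XF': "X ** F' = 0"
    by (simp_all add: E_def F_def E'_def F'_def complement_range_projector_mult
        mult_complement_range_projector)
  have E1: "A = E ** A + E' ** A" and F1: "A = A ** F + A ** F'" for A :: "real^'n^'m"
    by (simp_all add: E'_def F'_def matrix_mult.diff_left matrix_mult.diff_right)
  have "rank E = rank X" "rank F = rank X"
    by (simp_all add: E_def F_def rank_range_projector rank_transpose)
  have rt: "rank (t *\<^sub>R (E' ** G ** F')) \<le> r - rank X"
    using rank_scaleR_le rD order_trans by blast
  from BC show ?thesis
  proof
    assume B: "E ** G ** F' = 0"
    have "(X + t *\<^sub>R G) ** F' = t *\<^sub>R (G ** F')"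
      by (simp add: matrix_mult.add_left matrix_mult.scaleR_left XF')
    also have "G ** F' = E' ** G ** F'"
      using E1[of "G ** F'"] B by (simp add: matrix_mul_assoc)
    finally have eq: "X + t *\<^sub>R G = (X + t *\<^sub>R G) ** F + t *\<^sub>R (E' ** G ** F')"
      using F1[of "X + t *\<^sub>R G"] by simp
    have "rank (X + t *\<^sub>R G) \<le> rank ((X + t *\<^sub>R G) ** F) + rank (t *\<^sub>R (E' ** G ** F'))"
      by (subst eq) (rule rank_add_le)
    also have "\<dots> \<le> rank X + (r - rank X)"
      using rank_mul_le_right[of "X + t *\<^sub>R G" F] rt \<open>rank F = rank X\<close> by simp
    finally show ?thesis using X by simp
  next
    assume C: "E' ** G ** F = 0"
    have "E' ** (X + t *\<^sub>R G) = t *\<^sub>R (E' ** G)"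
      by (simp add: matrix_mult.add_right matrix_mult.scaleR_right E'X)
    also have "E' ** G = E' ** G ** F'"
      using F1[of "E' ** G"] C by simp
    finally have eq: "X + t *\<^sub>R G = E ** (X + t *\<^sub>R G) + t *\<^sub>R (E' ** G ** F')"
      using E1[of "X + t *\<^sub>R G"] by simp
    have "rank (X + t *\<^sub>R G) \<le> rank (E ** (X + t *\<^sub>R G)) + rank (t *\<^sub>R (E' ** G ** F'))"
      by (subst eq) (rule rank_add_le)
    also have "\<dots> \<le> rank X + (r - rank X)"
      using rank_mul_le_left[of E "X + t *\<^sub>R G"] rt \<open>rank E = rank X\<close> by simp
    finally show ?thesis using X by simp
  qed
qed

text \<open>
  These elements depend continuously on \<open>X\<close> although the cone itself does not.
\<close>

lemma mult_in_restricted_tangent_cone: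
  fixes X :: "real^'n^'m"
  shows "X ** N \<in> restricted_tangent_cone r X" and "M ** X \<in> restricted_tangent_cone r X"
proof -
  have "(mat 1 - range_projector X) ** (X ** N) = 0"
    by (simp add: matrix_mul_assoc complement_range_projector_mult matrix_mult.zero_left)
  then show "X ** N \<in> restricted_tangent_cone r X"
    by (simp add: restricted_tangent_cone_iff matrix_mult.zero_left)
  have "A ** (M ** X) ** (mat 1 - range_projector (transpose X)) = 0" for A :: "real^'m^'m"
    by (simp add: mult_complement_range_projector matrix_mult.zero_right flip: matrix_mul_assoc)
  then show "M ** X \<in> restricted_tangent_cone r X"
    by (simp add: restricted_tangent_cone_iff)
qed

text \<open>
  At maximal rank the lower right block is zero; the remaining blocks have their columns in the column
  space or their rows in the row space of \<open>X\<close>.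
\<close>

lemma tangent_cone_full_rank:
  fixes X :: "real^'n^'m"
  assumes "Z \<in> tangent_cone (rank X) X"
  obtains M N where "Z = X ** N + M ** X"
proof -
  define E F where "E = range_projector X" and "F = range_projector (transpose X)"
  obtain K where K: "E = X ** K" unfolding E_def by (rule range_projector_factor)
  obtain L where "F = transpose X ** L" unfolding F_def by (rule range_projector_factor)
  moreover have "transpose F = F"
    using orthogonal_projector_range_projector[of "transpose X"] by (simp add: F_def orthogonal_projector_def)
  ultimately have L: "F = transpose L ** X"
    by (metis matrix_transpose_mul transpose_transpose)
  have "(mat 1 - E) ** Z ** (mat 1 - F) = 0"
    using assms by (simp add: tangent_cone_iff E_def F_def rank_eq_0)
  then have "(mat 1 - E) ** Z = (mat 1 - E) ** Z ** F"
    by (simp add: matrix_mult.diff_right)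
  moreover have "Z = E ** Z + (mat 1 - E) ** Z"
    by (simp add: matrix_mult.diff_left)
  ultimately have "Z = E ** Z + (mat 1 - E) ** Z ** F" by simp
  then have "Z = X ** (K ** Z) + ((mat 1 - E) ** Z ** transpose L) ** X"
    unfolding K L by (simp add: matrix_mul_assoc)
  then show ?thesis by (rule that)
qed

text \<open>
  A matrix of small rank need not lie in the restricted tangent cone, as both of its off-diagonal blocks
  may be nonzero, but splitting off its component in the column space of \<open>X\<close> separates the two.
\<close>

lemma low_rank_split_in_restricted_tangent_cone:
  fixes X W :: "real^'n^'m"
  assumes "rank W \<le> r - rank X"
  shows "range_projector X ** W \<in> restricted_tangent_cone r X"
    and "(mat 1 - range_projector X) ** W \<in> restricted_tangent_cone r X"
proof -
  define E where "E = range_projector X"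
  have idem: "E ** E = E" by (simp add: E_def range_projector_idem)
  have "(mat 1 - E) ** (E ** W) = 0"
    by (simp add: matrix_mul_assoc matrix_mult.diff_left idem)
  then show "range_projector X ** W \<in> restricted_tangent_cone r X"
    by (simp add: restricted_tangent_cone_iff matrix_mult.zero_left flip: E_def)
  have "E ** ((mat 1 - E) ** W) = 0"
    by (simp add: matrix_mul_assoc matrix_mult.diff_left matrix_mult.diff_right idem)
  moreover have "rank ((mat 1 - E) ** ((mat 1 - E) ** W) ** A) \<le> r - rank X" for A :: "real^'n^'n"
    by (meson assms order_trans rank_mul_le_left rank_mul_le_right)
  ultimately show "(mat 1 - range_projector X) ** W \<in> restricted_tangent_cone r X"
    by (simp add: restricted_tangent_cone_iff matrix_mult.zero_left flip: E_def)
qed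

lemma inner_matrix_mult_left:
  fixes A :: "real^'n^'m" and B :: "real^'k^'n" and C :: "real^'k^'m"
  shows "(A ** B) \<bullet> C = B \<bullet> (transpose A ** C)"
proof -
  have "(A ** B) \<bullet> C = (\<Sum>i\<in>UNIV. \<Sum>j\<in>UNIV. \<Sum>k\<in>UNIV. A $ i $ k * B $ k $ j * C $ i $ j)"
    by (simp add: inner_vec_def matrix_matrix_mult_def sum_distrib_right)
  also have "\<dots> = (\<Sum>j\<in>UNIV. \<Sum>i\<in>UNIV. \<Sum>k\<in>UNIV. A $ i $ k * B $ k $ j * C $ i $ j)"
    by (rule sum.swap)
  also have "\<dots> = (\<Sum>j\<in>UNIV. \<Sum>k\<in>UNIV. \<Sum>i\<in>UNIV. A $ i $ k * B $ k $ j * C $ i $ j)"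
    by (intro sum.cong refl sum.swap)
  also have "\<dots> = (\<Sum>k\<in>UNIV. \<Sum>j\<in>UNIV. \<Sum>i\<in>UNIV. A $ i $ k * B $ k $ j * C $ i $ j)"
    by (rule sum.swap)
  also have "\<dots> = B \<bullet> (transpose A ** C)"
    by (simp add: inner_vec_def matrix_matrix_mult_def transpose_def sum_distrib_left mult_ac)
  finally show ?thesis .
qed

lemma norm_range_projector_split_le:
  fixes X W :: "real^'n^'m"
  shows "norm (range_projector X ** W) \<le> norm W" and "norm ((mat 1 - range_projector X) ** W) \<le> norm W"
proof -
  define E where "E = range_projector X"
  have sym: "transpose E = E" and idem: "E ** E = E"
    using orthogonal_projector_range_projector[of X]
    by (simp_all add: E_def range_projector_idem orthogonal_projector_def)
  have "(E ** W) \<bullet> ((mat 1 - E) ** W) = W \<bullet> (E ** ((mat 1 - E) ** W))"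
    using inner_matrix_mult_left[of E W] by (simp add: sym)
  also have "\<dots> = 0"
    by (simp add: matrix_mul_assoc matrix_mult.diff_left matrix_mult.diff_right idem)
  finally have "(norm (E ** W + (mat 1 - E) ** W))\<^sup>2 = (norm (E ** W))\<^sup>2 + (norm ((mat 1 - E) ** W))\<^sup>2"
    by (intro norm_add_Pythagorean) (simp add: orthogonal_def)
  then have W: "(norm W)\<^sup>2 = (norm (E ** W))\<^sup>2 + (norm ((mat 1 - E) ** W))\<^sup>2"
    by (simp add: matrix_mult.diff_left)
  have "norm (E ** W) \<le> norm W" "norm ((mat 1 - E) ** W) \<le> norm W"
    by (rule power2_le_imp_le; simp add: W)+
  then show "norm (range_projector X ** W) \<le> norm W" "norm ((mat 1 - range_projector X) ** W) \<le> norm W"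
    by (simp_all add: E_def)
qed

section \<open>Gradients, backtracking and the stationarity measure\<close>

lemma GDERIV_gradient:
  fixes f :: "'a::euclidean_space \<Rightarrow> real"
  assumes "f differentiable (at x)"
  shows "GDERIV f x :> gradient f x"
proof -
  obtain f' where f': "(f has_derivative f') (at x)"
    using assms unfolding differentiable_def by blast
  interpret f': bounded_linear f' using f' by (rule has_derivative_bounded_linear)
  define D where "D = (\<Sum>b\<in>Basis. f' b *\<^sub>R b)"
  have "f' h = h \<bullet> D" for h
  proof -
    have "f' h = f' (\<Sum>b\<in>Basis. (h \<bullet> b) *\<^sub>R b)" by (simp add: euclidean_representation)
    also have "\<dots> = h \<bullet> D"
      by (simp add: D_def f'.sum f'.scaleR inner_sum_right mult.commute)
    finally show ?thesis .
  qed
  then have "f' = (\<lambda>h. h \<bullet> D)" by (rule ext)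
  then have "GDERIV f x :> D"
    using f' by (simp add: gderiv_def)
  moreover have "D = D'" if "GDERIV f x :> D" "GDERIV f x :> D'" for D D'
  proof -
    have "(\<lambda>h. h \<bullet> D) = (\<lambda>h. h \<bullet> D')"
      using that unfolding gderiv_def by (rule has_derivative_unique)
    then show ?thesis by (metis inner_commute vector_eq_rdot)
  qed
  ultimately show ?thesis
    unfolding gradient_def by (metis theI)
qed

text \<open>
  The point of this form of the Armijo condition is that the threshold \<open>\<tau>\<close> for the step size is uniform
  over base points near \<open>A\<close> and over steepest descent like directions \<open>G\<close> of length at least \<open>g0\<close>. The
  mean value theorem reduces it to the gradient changing by at most \<open>(1 - c) * g0\<close> along the step.
\<close>

lemma sufficient_decrease_near:
  fixes f :: "'a::euclidean_space \<Rightarrow> real"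
  assumes deriv: "\<And>x. GDERIV f x :> g x" and cont: "isCont g A" and "0 < g0" and "c < 1"
  obtains \<epsilon> \<tau> where "0 < \<epsilon>" "0 < \<tau>"
    "\<And>X G a. dist A X < \<epsilon> \<Longrightarrow> g X \<bullet> G = - (norm G)\<^sup>2 \<Longrightarrow> g0 \<le> norm G \<Longrightarrow> 0 < a \<Longrightarrow> a \<le> \<tau> \<Longrightarrow>
      f (X + a *\<^sub>R G) \<le> f X - c * a * (norm G)\<^sup>2"
proof -
  define \<eta> where "\<eta> = (1 - c) * g0 / 2"
  have "\<eta> > 0" using assms(3,4) by (simp add: \<eta>_def)
  then obtain \<delta> where \<delta>: "\<delta> > 0" "\<And>Y. dist Y A < \<delta> \<Longrightarrow> dist (g Y) (g A) < \<eta>"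
    using cont unfolding continuous_at_eps_delta by blast
  define M where "M = norm (g A) + \<eta>"
  have M: "M > 0" using \<open>\<eta> > 0\<close> by (simp add: M_def add_nonneg_pos)
  define \<tau> where "\<tau> = \<delta> / (2 * M)"
  show ?thesis
  proof (rule that[of "\<delta> / 2" \<tau>])
    \<comment> \<open>The bound \<open>M\<close> on \<open>norm G\<close> keeps steps of size at most \<open>\<tau>\<close> from \<open>X\<close> inside the ball of radius \<open>\<delta>\<close> around \<open>A\<close>.\<close>
    show "0 < \<delta> / 2" "0 < \<tau>" using \<delta>(1) M by (simp_all add: \<tau>_def)
    fix X G a
    assume X: "dist A X < \<delta> / 2" and inner: "g X \<bullet> G = - (norm G)\<^sup>2" and G: "g0 \<le> norm G"
      and a: "0 < a" "a \<le> \<tau>"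
    have gX: "dist (g X) (g A) < \<eta>"
      using X \<delta>(1) dist_commute[of A X] by (intro \<delta>(2)) linarith
    have "norm (g X) \<le> M"
      using gX norm_triangle_sub[of "g X" "g A"] by (simp add: M_def dist_norm)
    moreover have "(norm G)\<^sup>2 \<le> norm (g X) * norm G"
      using Cauchy_Schwarz_ineq2[of "g X" G] inner by simp
    then have "norm G * norm G \<le> norm (g X) * norm G"
      by (simp add: power2_eq_square)
    then have "norm G \<le> norm (g X)"
      by (rule mult_right_le_imp_le) (use G \<open>0 < g0\<close> in linarith)
    ultimately have GM: "norm G \<le> M" by simp
    have "((\<lambda>t. f (X + t *\<^sub>R G)) has_real_derivative G \<bullet> g (X + t *\<^sub>R G)) (at t)" for t
    proof -
      have "((\<lambda>t. X + t *\<^sub>R G) has_derivative (\<lambda>h. h *\<^sub>R G)) (at t)"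
        by (auto intro!: derivative_eq_intros)
      moreover have "(f has_derivative (\<lambda>h. h \<bullet> g (X + t *\<^sub>R G))) (at (X + t *\<^sub>R G))"
        using deriv by (simp add: gderiv_def)
      ultimately have "((\<lambda>t. f (X + t *\<^sub>R G)) has_derivative (\<lambda>h. (h *\<^sub>R G) \<bullet> g (X + t *\<^sub>R G))) (at t)"
        by (rule has_derivative_compose)
      then show ?thesis
        by (simp add: has_field_derivative_def mult_commute_abs)
    qed
    then obtain z where z: "0 < z" "z < a"
      "f (X + a *\<^sub>R G) - f (X + 0 *\<^sub>R G) = (a - 0) * (G \<bullet> g (X + z *\<^sub>R G))"
      using MVT2[OF a(1), of "\<lambda>t. f (X + t *\<^sub>R G)" "\<lambda>t. G \<bullet> g (X + t *\<^sub>R G)"] by blast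
    have "z * norm G \<le> \<tau> * M"
      using z a GM by (intro mult_mono) auto
    also have "\<dots> = \<delta> / 2" using M by (simp add: \<tau>_def)
    finally have zG: "z * norm G \<le> \<delta> / 2" .
    have "dist (X + z *\<^sub>R G) A \<le> dist (X + z *\<^sub>R G) X + dist X A"
      by (rule dist_triangle)
    also have "\<dots> < \<delta>"
      using zG X z(1) by (simp add: dist_norm norm_minus_commute)
    finally have "dist (g (X + z *\<^sub>R G)) (g A) < \<eta>" by (rule \<delta>(2))
    then have "norm (g (X + z *\<^sub>R G) - g X) \<le> 2 * \<eta>"
      using gX dist_triangle2[of "g (X + z *\<^sub>R G)" "g X" "g A"] by (simp add: dist_norm)
    then have "G \<bullet> (g (X + z *\<^sub>R G) - g X) \<le> norm G * (2 * \<eta>)"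
      using norm_cauchy_schwarz[of G "g (X + z *\<^sub>R G) - g X"] mult_left_mono[OF _ norm_ge_zero]
      by (meson order_trans)
    also have "\<dots> \<le> norm G * ((1 - c) * norm G)"
      using G \<open>c < 1\<close> by (intro mult_left_mono) (simp_all add: \<eta>_def)
    finally have "G \<bullet> g (X + z *\<^sub>R G) \<le> - c * (norm G)\<^sup>2"
      using inner by (simp add: inner_diff_right inner_commute[of G "g X"] algebra_simps power2_eq_square)
    then have "a * (G \<bullet> g (X + z *\<^sub>R G)) \<le> a * (- c * (norm G)\<^sup>2)"
      using a(1) by (intro mult_left_mono) auto
    then show "f (X + a *\<^sub>R G) \<le> f X - c * a * (norm G)\<^sup>2"
      using z(3) by (simp add: mult_ac)
  qed
qed

lemma funpow_mult_right: "((\<lambda>a. a * \<beta>) ^^ k) a = a * \<beta> ^ k" for a \<beta> :: real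
  by (induction k) simp_all

lemma backtracking_terminates:
  fixes \<beta> :: real
  assumes "0 < \<beta>" "\<beta> < 1" "0 < \<alpha>\<^sub>0" "0 < \<tau>" and accept: "\<And>a. 0 < a \<Longrightarrow> a \<le> \<tau> \<Longrightarrow> \<not> b a"
  shows "\<exists>\<alpha>. while_option b (\<lambda>a. a * \<beta>) \<alpha>\<^sub>0 = Some \<alpha>"
proof -
  obtain k where "\<beta> ^ k < \<tau> / \<alpha>\<^sub>0"
    using real_arch_pow_inv[of "\<tau> / \<alpha>\<^sub>0" \<beta>] assms by auto
  then have "\<alpha>\<^sub>0 * \<beta> ^ k \<le> \<tau>" using \<open>0 < \<alpha>\<^sub>0\<close> by (simp add: field_simps)
  then have "\<not> b (((\<lambda>a. a * \<beta>) ^^ k) \<alpha>\<^sub>0)"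
    unfolding funpow_mult_right using assms by (intro accept) simp_all
  then show ?thesis unfolding while_option_def by auto
qed

text \<open>
  A step size is only reduced after it has been rejected, hence while it exceeds \<open>\<tau>\<close>.
\<close>

lemma backtracking_lower_bound:
  fixes \<beta> :: real
  assumes "while_option b (\<lambda>a. a * \<beta>) \<alpha>\<^sub>0 = Some \<alpha>"
    and "0 < \<beta>" "0 < \<alpha>\<^sub>0" and accept: "\<And>a. 0 < a \<Longrightarrow> a \<le> \<tau> \<Longrightarrow> \<not> b a"
  shows "0 < \<alpha>" "min \<alpha>\<^sub>0 (\<beta> * \<tau>) \<le> \<alpha>"
proof -
  have "0 < \<alpha> \<and> min \<alpha>\<^sub>0 (\<beta> * \<tau>) \<le> \<alpha>"
    using _ assms(1)
  proof (rule while_option_rule)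
    fix a assume a: "0 < a \<and> min \<alpha>\<^sub>0 (\<beta> * \<tau>) \<le> a" "b a"
    then have "\<tau> < a" using accept[of a] by linarith
    then have "\<beta> * \<tau> \<le> a * \<beta>" using \<open>0 < \<beta>\<close> by (simp add: mult.commute)
    then have "min \<alpha>\<^sub>0 (\<beta> * \<tau>) \<le> a * \<beta>" by linarith
    then show "0 < a * \<beta> \<and> min \<alpha>\<^sub>0 (\<beta> * \<tau>) \<le> a * \<beta>" using a(1) \<open>0 < \<beta>\<close> by simp
  qed (use assms in auto)
  then show "0 < \<alpha>" "min \<alpha>\<^sub>0 (\<beta> * \<tau>) \<le> \<alpha>" by auto
qed

lemma restricted_projection_exists:
  fixes X :: "real^'n^'m"
  shows "metric_projection (restricted_tangent_cone r X) Z \<noteq> {}"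
  using metric_projection_nonempty[OF closed_restricted_tangent_cone] zero_in_restricted_tangent_cone
  by blast

text \<open>
  Any two projections of a point onto a cone bound each other's norm.
\<close>

lemma stationarity_measure_eq_norm:
  fixes X :: "real^'n^'m"
  assumes G: "G \<in> metric_projection (tangent_cone r X) (- gradient f X)"
  shows "stationarity_measure f r X = norm G"
proof -
  have le: "norm G1 \<le> norm G2" if
    G1: "G1 \<in> metric_projection (tangent_cone r X) (- gradient f X)" and
    G2: "G2 \<in> metric_projection (tangent_cone r X) (- gradient f X)" for G1 G2
  proof -
    have "(norm G1)\<^sup>2 = (- gradient f X) \<bullet> G1"
      by (rule metric_projection_cone_inner_self[symmetric, OF cone_tangent_cone G1])
    also have "G1 \<in> tangent_cone r X"
      using G1 by (simp add: metric_projection_iff)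
    then have "(- gradient f X) \<bullet> G1 \<le> norm G2 * norm G1"
      by (rule metric_projection_cone_inner_le[OF cone_tangent_cone G2])
    finally show ?thesis by (cases "G1 = 0") (simp_all add: power2_eq_square)
  qed
  have "norm ` metric_projection (tangent_cone r X) (- gradient f X) = {norm G}"
    using G le by (auto intro: antisym)
  then show ?thesis by (simp add: stationarity_measure_def)
qed

lemma stationarity_measure_props:
  fixes X :: "real^'n^'m"
  shows stationarity_measure_nonneg: "0 \<le> stationarity_measure f r X"
    and descent_direction_if_not_stationary: "stationarity_measure f r X \<noteq> 0 \<Longrightarrow>
      \<exists>W\<in>tangent_cone r X. 0 < (- gradient f X) \<bullet> W"
proof -
  obtain G where G: "G \<in> metric_projection (tangent_cone r X) (- gradient f X)"
    using metric_projection_nonempty[OF closed_tangent_cone] zero_in_tangent_cone by blast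
  show "0 \<le> stationarity_measure f r X"
    by (simp add: stationarity_measure_eq_norm[OF G])
  assume "stationarity_measure f r X \<noteq> 0"
  then have "0 < (- gradient f X) \<bullet> G"
    by (simp add: stationarity_measure_eq_norm[OF G]
        metric_projection_cone_inner_self[OF cone_tangent_cone G] del: inner_minus_left)
  then show "\<exists>W\<in>tangent_cone r X. 0 < (- gradient f X) \<bullet> W"
    using G by (auto simp: metric_projection_iff)
qed

text \<open>
  Here \<open>z\<close> is a vector field to be projected onto cones, \<open>w X\<close> is an element of the cone at \<open>X\<close> or the sum of
  two elements not longer than \<open>w X\<close> (whence the factor 2), and \<open>t\<close> is the length of a projection.
\<close>

lemma positive_inner_near:
  fixes z w :: "'a::metric_space \<Rightarrow> 'b::real_inner"
  assumes "isCont z A" "isCont w A" "0 < z A \<bullet> w A"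
  obtains \<epsilon> g0 where "0 < \<epsilon>" "0 < g0"
    "\<And>X t. dist A X < \<epsilon> \<Longrightarrow> z X \<bullet> w X \<le> 2 * (t * norm (w X)) \<Longrightarrow> g0 \<le> t"
proof -
  define p where "p = z A \<bullet> w A"
  define M where "M = norm (w A) + 1"
  have "p > 0" "M > 0" using assms(3) by (simp_all add: p_def M_def add_nonneg_pos)
  have "isCont (\<lambda>X. z X \<bullet> w X) A" "isCont (\<lambda>X. norm (w X)) A"
    using assms(1,2) by (auto intro!: continuous_intros)
  then have "((\<lambda>X. z X \<bullet> w X) \<longlongrightarrow> p) (nhds A)" "((\<lambda>X. norm (w X)) \<longlongrightarrow> norm (w A)) (nhds A)"
    unfolding isCont_def p_def
    using tendsto_at_iff_tendsto_nhds[of "\<lambda>X. z X \<bullet> w X" A] tendsto_at_iff_tendsto_nhds[of "\<lambda>X. norm (w X)" A]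
    by blast+
  then have "eventually (\<lambda>X. p / 2 < z X \<bullet> w X) (nhds A)" "eventually (\<lambda>X. norm (w X) < M) (nhds A)"
    using order_tendstoD(1)[of _ p "nhds A" "p / 2"] order_tendstoD(2)[of _ "norm (w A)" "nhds A" M] \<open>p > 0\<close>
    by (simp_all add: M_def)
  then have "eventually (\<lambda>X. p / 2 < z X \<bullet> w X \<and> norm (w X) < M) (nhds A)"
    by (rule eventually_conj)
  then obtain \<epsilon> where \<epsilon>: "\<epsilon> > 0" "\<And>X. dist X A < \<epsilon> \<Longrightarrow> p / 2 < z X \<bullet> w X \<and> norm (w X) < M"
    unfolding eventually_nhds_metric by blast
  show ?thesis
  proof (rule that[of \<epsilon> "p / (4 * M)"])
    show "0 < \<epsilon>" "0 < p / (4 * M)" using \<epsilon>(1) \<open>p > 0\<close> \<open>M > 0\<close> by simp_all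
    fix X t assume X: "dist A X < \<epsilon>" and t: "z X \<bullet> w X \<le> 2 * (t * norm (w X))"
    have *: "p / 2 < z X \<bullet> w X" "norm (w X) < M" using \<epsilon>(2)[of X] X by (auto simp: dist_commute)
    then have "0 < t * norm (w X)" using t \<open>p > 0\<close> by linarith
    then have "0 < t" by (simp add: zero_less_mult_iff not_less[symmetric])
    then have "t * norm (w X) \<le> t * M" using *(2) by simp
    then have "p / 2 \<le> 2 * (t * M)" using * t by linarith
    then show "p / (4 * M) \<le> t" using \<open>M > 0\<close> by (simp add: field_simps)
  qed
qed

section \<open>Steps of the algorithm\<close>

text \<open>
  The data of the algorithm, with the smoothness of \<open>f\<close> in the form in which it enters: differentiability
  together with continuity of the gradient.
\<close>

locale rank_constrained_descent =
  fixes f :: "real^'n^'m \<Rightarrow> real" and r :: nat and \<alpha>\<^sub>l \<alpha>\<^sub>u \<beta> c \<Delta> :: real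
  assumes r_pos: "0 < r" and r_less: "r < min CARD('m) CARD('n)"
    and deriv: "\<And>Z. GDERIV f Z :> gradient f Z" and gradient_cont: "\<And>Z. isCont (gradient f) Z"
    and \<alpha>\<^sub>l_pos: "0 < \<alpha>\<^sub>l" and \<alpha>_le: "\<alpha>\<^sub>l \<le> \<alpha>\<^sub>u" and \<beta>: "0 < \<beta>" "\<beta> < 1" and c: "0 < c" "c < 1"
    and \<Delta>_pos: "0 < \<Delta>"
begin

abbreviation descent_directions where
  "descent_directions X \<equiv> metric_projection (restricted_tangent_cone r X) (- gradient f X)"

abbreviation rfd where "rfd \<equiv> RFD f r \<alpha>\<^sub>l \<alpha>\<^sub>u \<beta> c"

abbreviation rfdr where "rfdr \<equiv> RFDR f r \<alpha>\<^sub>l \<alpha>\<^sub>u \<beta> c \<Delta>"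

lemma f_cont: "isCont f Z"
  using deriv[of Z] unfolding gderiv_def by (rule has_derivative_continuous)

lemma descent_direction_inner:
  assumes "G \<in> descent_directions X"
  shows "gradient f X \<bullet> G = - (norm G)\<^sup>2"
  using metric_projection_cone_inner_self[OF cone_restricted_tangent_cone assms] by simp

lemma rfdE:
  assumes "Y \<in> rfd X"
  obtains G \<alpha>\<^sub>0 \<alpha> where "G \<in> descent_directions X" "\<alpha>\<^sub>l \<le> \<alpha>\<^sub>0" "Y = X + \<alpha> *\<^sub>R G" "0 < \<alpha>"
    "while_option (\<lambda>a. f (X + a *\<^sub>R G) > f X - c * a * (norm G)\<^sup>2) (\<lambda>a. a * \<beta>) \<alpha>\<^sub>0 = Some \<alpha>"
    "f Y \<le> f X - c * \<alpha> * (norm G)\<^sup>2"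
proof -
  obtain G \<alpha> where G: "G \<in> descent_directions X" "Y = X + \<alpha> *\<^sub>R G"
    and "\<exists>\<alpha>\<^sub>0\<in>{\<alpha>\<^sub>l..\<alpha>\<^sub>u}. while_option (\<lambda>a. f (X + a *\<^sub>R G) > f X - c * a * (norm G)\<^sup>2)
      (\<lambda>a. a * \<beta>) \<alpha>\<^sub>0 = Some \<alpha>"
    using assms unfolding RFD_def mem_Collect_eq by (elim exE conjE)
  then obtain \<alpha>\<^sub>0 where \<alpha>\<^sub>0: "\<alpha>\<^sub>l \<le> \<alpha>\<^sub>0" and loop:
    "while_option (\<lambda>a. f (X + a *\<^sub>R G) > f X - c * a * (norm G)\<^sup>2) (\<lambda>a. a * \<beta>) \<alpha>\<^sub>0 = Some \<alpha>"
    unfolding atLeastAtMost_iff Bex_def by (elim exE conjE)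
  have "0 < \<alpha>"
    using backtracking_lower_bound(1)[OF loop \<beta>(1), of 0] \<alpha>\<^sub>0 \<alpha>\<^sub>l_pos by auto
  moreover have "f Y \<le> f X - c * \<alpha> * (norm G)\<^sup>2"
    using while_option_stop[OF loop] G(2) by simp
  ultimately show ?thesis by (rule that[OF G(1) \<alpha>\<^sub>0 G(2) _ loop])
qed

lemma rfd_descends: "Y \<in> rfd X \<Longrightarrow> f Y \<le> f X"
proof (elim rfdE)
  fix G \<alpha> assume "f Y \<le> f X - c * \<alpha> * (norm G)\<^sup>2" "0 < \<alpha>"
  moreover have "0 \<le> c * \<alpha> * (norm G)\<^sup>2" using c \<open>0 < \<alpha>\<close> by simp
  ultimately show "f Y \<le> f X" by linarith
qed

lemma rfd_rank_le: "Y \<in> rfd X \<Longrightarrow> rank X \<le> r \<Longrightarrow> rank Y \<le> r"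
  by (elim rfdE) (auto simp: metric_projection_iff intro: rank_le_add_restricted_tangent_cone)

lemma rfd_nonempty: "rfd X \<noteq> {}"
proof -
  obtain G where G: "G \<in> descent_directions X"
    using restricted_projection_exists by blast
  let ?b = "\<lambda>a. f (X + a *\<^sub>R G) > f X - c * a * (norm G)\<^sup>2"
  obtain \<tau> where "0 < \<tau>" "\<And>a. 0 < a \<Longrightarrow> a \<le> \<tau> \<Longrightarrow> \<not> ?b a"
  proof (cases "G = 0")
    case True
    then show ?thesis using that[of 1] by simp
  next
    case False
    then obtain \<epsilon> \<tau> where "0 < \<epsilon>" "0 < \<tau>"
      "\<And>Y H a. dist X Y < \<epsilon> \<Longrightarrow> gradient f Y \<bullet> H = - (norm H)\<^sup>2 \<Longrightarrow> norm G \<le> norm H \<Longrightarrow> 0 < a \<Longrightarrow> a \<le> \<tau> \<Longrightarrow>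
        f (Y + a *\<^sub>R H) \<le> f Y - c * a * (norm H)\<^sup>2"
      using sufficient_decrease_near[OF deriv gradient_cont _ c(2), of "norm G" X] by auto
    then show ?thesis
      using descent_direction_inner[OF G] by (intro that[of \<tau>]) (auto simp: not_less)
  qed
  then obtain \<alpha> where "while_option ?b (\<lambda>a. a * \<beta>) \<alpha>\<^sub>l = Some \<alpha>"
    using backtracking_terminates[OF \<beta> \<alpha>\<^sub>l_pos, of \<tau> ?b] by blast
  then have "X + \<alpha> *\<^sub>R G \<in> rfd X"
    unfolding RFD_def using G \<alpha>_le
    by (intro CollectI exI[of _ \<alpha>] exI[of _ G] conjI bexI[of _ \<alpha>\<^sub>l]) auto
  then show ?thesis by blast
qed

text \<open>
  Step sizes and directions bounded below give a decrease \<open>\<delta>\<close> that is uniform near \<open>A\<close>, and closer to \<open>A\<close>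
  the value of \<open>f\<close> at the base point exceeds \<open>f A\<close> by less than \<open>\<delta>\<close>.
\<close>

lemma rfd_below_near:
  assumes "0 < g0"
  obtains \<epsilon> where "0 < \<epsilon>"
    "\<And>X Y. dist A X < \<epsilon> \<Longrightarrow> \<forall>G\<in>descent_directions X. g0 \<le> norm G \<Longrightarrow> Y \<in> rfd X \<Longrightarrow> f Y < f A"
proof -
  obtain \<epsilon> \<tau> where \<epsilon>: "0 < \<epsilon>" and \<tau>: "0 < \<tau>" and armijo:
    "\<And>X G a. dist A X < \<epsilon> \<Longrightarrow> gradient f X \<bullet> G = - (norm G)\<^sup>2 \<Longrightarrow> g0 \<le> norm G \<Longrightarrow> 0 < a \<Longrightarrow> a \<le> \<tau> \<Longrightarrow>
      f (X + a *\<^sub>R G) \<le> f X - c * a * (norm G)\<^sup>2"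
    using sufficient_decrease_near[OF deriv gradient_cont \<open>0 < g0\<close> c(2), of A] by blast
  define \<delta> where "\<delta> = c * min \<alpha>\<^sub>l (\<beta> * \<tau>) * g0\<^sup>2"
  have "\<delta> > 0" using c \<beta> \<alpha>\<^sub>l_pos \<tau> \<open>0 < g0\<close> by (simp add: \<delta>_def)
  then obtain \<epsilon>' where \<epsilon>': "\<epsilon>' > 0" "\<And>X. dist X A < \<epsilon>' \<Longrightarrow> dist (f X) (f A) < \<delta>"
    using f_cont[of A] unfolding continuous_at_eps_delta by blast
  show ?thesis
  proof (rule that[of "min \<epsilon> \<epsilon>'"])
    show "0 < min \<epsilon> \<epsilon>'" using \<epsilon> \<epsilon>' by simp
    fix X Y assume X: "dist A X < min \<epsilon> \<epsilon>'" and large: "\<forall>G\<in>descent_directions X. g0 \<le> norm G"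
      and "Y \<in> rfd X"
    then obtain G \<alpha>\<^sub>0 \<alpha> where G: "G \<in> descent_directions X" "\<alpha>\<^sub>l \<le> \<alpha>\<^sub>0" "0 < \<alpha>"
      "while_option (\<lambda>a. f (X + a *\<^sub>R G) > f X - c * a * (norm G)\<^sup>2) (\<lambda>a. a * \<beta>) \<alpha>\<^sub>0 = Some \<alpha>"
      "f Y \<le> f X - c * \<alpha> * (norm G)\<^sup>2"
      by (elim rfdE)
    have "g0 \<le> norm G" using large G(1) by blast
    then have "min \<alpha>\<^sub>0 (\<beta> * \<tau>) \<le> \<alpha>"
      using armijo[of X G] X descent_direction_inner[OF G(1)] G(2) \<alpha>\<^sub>l_pos
      by (intro backtracking_lower_bound(2)[OF G(4) \<beta>(1)]) (auto simp: not_less)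
    then have "min \<alpha>\<^sub>l (\<beta> * \<tau>) \<le> \<alpha>" using G(2) by linarith
    then have "\<delta> \<le> c * \<alpha> * (norm G)\<^sup>2"
      unfolding \<delta>_def using G(3) c(1) \<beta>(1) \<alpha>\<^sub>l_pos \<tau> \<open>0 < g0\<close> \<open>g0 \<le> norm G\<close>
      by (intro mult_mono power_mono) auto
    moreover have "f X < f A + \<delta>"
      using \<epsilon>'(2)[of X] X by (simp add: dist_commute dist_real_def abs_less_iff)
    ultimately show "f Y < f A" using G(5) by linarith
  qed
qed

lemma rfdr_below_rfd:
  assumes "Y \<in> rfdr X"
  obtains X' where "X' \<in> rfd X" "f Y \<le> f X'"
  using assms unfolding RFDR_def is_arg_min_linorder
  by (cases "singular_value r X \<in> {0<..\<Delta>}") auto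

lemma rfdr_descends: "Y \<in> rfdr X \<Longrightarrow> f Y \<le> f X"
  by (meson order_trans rfd_descends rfdr_below_rfd)

lemma rfdr_rank_le:
  assumes "Y \<in> rfdr X" "rank X \<le> r"
  shows "rank Y \<le> r"
proof -
  have "Y \<in> rfd X \<or> (\<exists>H\<in>metric_projection (rank_eq (r - 1)) X. Y \<in> rfd H)"
    using assms(1) unfolding RFDR_def is_arg_min_linorder
    by (auto split: if_splits)
  then show ?thesis
    using assms(2) by (auto simp: metric_projection_iff rank_eq_def intro: rfd_rank_le)
qed

lemma singular_value_r_pos_iff: "0 < singular_value r X \<longleftrightarrow> r \<le> rank X" for X :: "real^'n^'m"
  using r_pos r_less by (intro singular_value_pos_iff) auto

lemma rfdr_nonempty: "rfdr X \<noteq> {}"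
proof -
  obtain X' where X': "X' \<in> rfd X" using rfd_nonempty by blast
  show ?thesis
  proof (cases "singular_value r X \<in> {0<..\<Delta>}")
    case True
    then have "r \<le> rank X" using singular_value_r_pos_iff[of X] by simp
    then have "r - 1 < rank X" using r_pos by linarith
    moreover have "metric_projection (rank_le (r - 1)) X \<noteq> {}"
      by (rule metric_projection_nonempty[OF closed_rank_le]) (auto simp: rank_le_def intro: exI[of _ 0])
    ultimately obtain H where H: "H \<in> metric_projection (rank_eq (r - 1)) X"
      using metric_projection_rank_eq[of "r - 1" X] by auto
    obtain R where R: "R \<in> rfd H" using rfd_nonempty by blast
    define Y where "Y = (if f X' \<le> f R then X' else R)"
    have "is_arg_min f (\<lambda>Z. Z \<in> {X', R}) Y"
      by (auto simp: Y_def is_arg_min_linorder)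
    then have "Y \<in> rfdr X" unfolding RFDR_def using True X' H R by auto
    then show ?thesis by blast
  next
    case False
    then have "X' \<in> rfdr X" unfolding RFDR_def using X' by auto
    then show ?thesis by blast
  qed
qed

text \<open>
  A descent direction in the tangent cone at \<open>A\<close> is a sum \<open>A ** N + M ** A\<close>. One of the two terms is itself
  a descent direction, and it extends to the family \<open>X ** N\<close> or \<open>M ** X\<close> of elements of the restricted
  tangent cones at nearby points.
\<close>

lemma large_directions_near_full_rank:
  assumes A: "rank A = r" and ns: "stationarity_measure f r A \<noteq> 0"
  obtains \<epsilon> g0 where "0 < \<epsilon>" "0 < g0"
    "\<And>X G. dist A X < \<epsilon> \<Longrightarrow> G \<in> descent_directions X \<Longrightarrow> g0 \<le> norm G"
proof -
  obtain W where "W \<in> tangent_cone r A" and W: "0 < (- gradient f A) \<bullet> W"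
    using descent_direction_if_not_stationary[OF ns] by blast
  then obtain M N where "W = A ** N + M ** A"
    using A tangent_cone_full_rank by metis
  then have "0 < (- gradient f A) \<bullet> (A ** N) \<or> 0 < (- gradient f A) \<bullet> (M ** A)"
    using W by (auto simp: inner_add_right not_less)
  then obtain w :: "real^'n^'m \<Rightarrow> real^'n^'m" where w: "isCont w A" "0 < (- gradient f A) \<bullet> w A"
    "\<And>X. w X \<in> restricted_tangent_cone r X"
  proof
    assume "0 < (- gradient f A) \<bullet> (A ** N)"
    then show ?thesis
      using mult_in_restricted_tangent_cone(1)
      by (intro that[of "\<lambda>X. X ** N"]) (auto intro!: matrix_mult.isCont)
  next
    assume "0 < (- gradient f A) \<bullet> (M ** A)"
    then show ?thesis
      using mult_in_restricted_tangent_cone(2)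
      by (intro that[of "\<lambda>X. M ** X"]) (auto intro!: matrix_mult.isCont)
  qed
  have cont: "isCont (\<lambda>X. - gradient f X) A"
    using gradient_cont by (intro continuous_intros)
  obtain \<epsilon> g0 where pos: "0 < \<epsilon>" "0 < g0" and bound:
    "\<And>X t. dist A X < \<epsilon> \<Longrightarrow> (- gradient f X) \<bullet> w X \<le> 2 * (t * norm (w X)) \<Longrightarrow> g0 \<le> t"
    using positive_inner_near[OF cont w(1,2)] by blast
  have large: "g0 \<le> norm G" if "dist A X < \<epsilon>" "G \<in> descent_directions X" for X G
  proof (rule bound[OF that(1)])
    have "(- gradient f X) \<bullet> w X \<le> norm G * norm (w X)"
      by (rule metric_projection_cone_inner_le[OF cone_restricted_tangent_cone that(2) w(3)])
    then show "(- gradient f X) \<bullet> w X \<le> 2 * (norm G * norm (w X))"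
      using mult_nonneg_nonneg[OF norm_ge_zero[of G] norm_ge_zero[of "w X"]] by linarith
  qed
  from pos large show ?thesis by (rule that)
qed

text \<open>
  At points of rank less than \<open>r\<close>, one fixed matrix \<open>W\<close> of rank one serves for all \<open>X\<close> near \<open>A\<close>; its two
  components depend discontinuously on \<open>X\<close>, but their norms are at most \<open>norm W\<close> and their inner products
  with the negative gradient add up to that of \<open>W\<close>.
\<close>

lemma large_directions_near_low_rank:
  assumes ns: "stationarity_measure f r A \<noteq> 0"
  obtains \<epsilon> g0 where "0 < \<epsilon>" "0 < g0"
    "\<And>X G. dist A X < \<epsilon> \<Longrightarrow> rank X < r \<Longrightarrow> G \<in> descent_directions X \<Longrightarrow> g0 \<le> norm G"
proof -
  have "- gradient f A \<noteq> 0"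
    using descent_direction_if_not_stationary[OF ns] by force
  then obtain W where W: "rank W \<le> 1" "0 < (- gradient f A) \<bullet> W"
    by (rule exists_rank_one_positive_inner)
  have cont: "isCont (\<lambda>X. - gradient f X) A"
    using gradient_cont by (intro continuous_intros)
  obtain \<epsilon> g0 where pos: "0 < \<epsilon>" "0 < g0" and bound:
    "\<And>X t. dist A X < \<epsilon> \<Longrightarrow> (- gradient f X) \<bullet> W \<le> 2 * (t * norm W) \<Longrightarrow> g0 \<le> t"
    using positive_inner_near[OF cont continuous_const W(2)] by blast
  have large: "g0 \<le> norm G" if "dist A X < \<epsilon>" "rank X < r" and G: "G \<in> descent_directions X" for X G
  proof (rule bound[OF that(1)])
    define W1 W2 where "W1 = range_projector X ** W" and "W2 = (mat 1 - range_projector X) ** W"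
    have "rank W \<le> r - rank X" using W(1) \<open>rank X < r\<close> by linarith
    note cone = low_rank_split_in_restricted_tangent_cone[OF this, folded W1_def W2_def]
    have "W = W1 + W2"
      by (simp add: W1_def W2_def matrix_mult.diff_left)
    then have "(- gradient f X) \<bullet> W = (- gradient f X) \<bullet> W1 + (- gradient f X) \<bullet> W2"
      by (simp add: inner_add_right)
    also have "\<dots> \<le> norm G * norm W1 + norm G * norm W2"
      by (intro add_mono metric_projection_cone_inner_le[OF cone_restricted_tangent_cone G] cone)
    also have "\<dots> \<le> norm G * norm W + norm G * norm W"
      unfolding W1_def W2_def by (intro add_mono mult_left_mono norm_range_projector_split_le norm_ge_zero)
    finally show "(- gradient f X) \<bullet> W \<le> 2 * (norm G * norm W)" by simp
  qed
  from pos large show ?thesis by (rule that)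
qed

text \<open>
  If \<open>rank A < r\<close>, short search directions are possible at points \<open>X\<close> of rank \<open>r\<close> near \<open>A\<close>. Such a point has
  \<open>\<sigma>\<^sub>r(X)\<close> in the range that triggers the rank reduction, and the step from the reduced point \<open>H\<close> of rank
  \<open>r - 1\<close> does the job: as \<open>A\<close> competes in the projection, \<open>H\<close> has at most twice the distance from \<open>A\<close> that
  \<open>X\<close> has.
\<close>

lemma rfdr_below_near:
  assumes A: "rank A \<le> r" and ns: "stationarity_measure f r A \<noteq> 0"
  obtains \<epsilon> where "0 < \<epsilon>" "\<And>X Y. dist A X < \<epsilon> \<Longrightarrow> rank X \<le> r \<Longrightarrow> Y \<in> rfdr X \<Longrightarrow> f Y < f A"
proof (cases "rank A = r")
  case True
  obtain \<epsilon>1 g0 where 1: "0 < \<epsilon>1" "0 < g0"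
    "\<And>X G. dist A X < \<epsilon>1 \<Longrightarrow> G \<in> descent_directions X \<Longrightarrow> g0 \<le> norm G"
    using large_directions_near_full_rank[OF True ns] by blast
  obtain \<epsilon>2 where 2: "0 < \<epsilon>2"
    "\<And>X Y. dist A X < \<epsilon>2 \<Longrightarrow> \<forall>G\<in>descent_directions X. g0 \<le> norm G \<Longrightarrow> Y \<in> rfd X \<Longrightarrow> f Y < f A"
    using rfd_below_near[OF \<open>0 < g0\<close>, of A] by blast
  show ?thesis
  proof (rule that[of "min \<epsilon>1 \<epsilon>2"])
    show "0 < min \<epsilon>1 \<epsilon>2" using 1 2 by simp
    fix X Y assume "dist A X < min \<epsilon>1 \<epsilon>2" "Y \<in> rfdr X"
    moreover then obtain X' where "X' \<in> rfd X" "f Y \<le> f X'" by (elim rfdr_below_rfd)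
    ultimately show "f Y < f A" using 1(3)[of X] 2(2)[of X X'] by force
  qed
next
  case False
  then have less: "rank A < r" using A by simp
  obtain \<epsilon>1 g0 where 1: "0 < \<epsilon>1" "0 < g0"
    "\<And>X G. dist A X < \<epsilon>1 \<Longrightarrow> rank X < r \<Longrightarrow> G \<in> descent_directions X \<Longrightarrow> g0 \<le> norm G"
    using large_directions_near_low_rank[OF ns] by blast
  obtain \<epsilon>2 where 2: "0 < \<epsilon>2"
    "\<And>X Y. dist A X < \<epsilon>2 \<Longrightarrow> \<forall>G\<in>descent_directions X. g0 \<le> norm G \<Longrightarrow> Y \<in> rfd X \<Longrightarrow> f Y < f A"
    using rfd_below_near[OF \<open>0 < g0\<close>, of A] by blast
  have low: "f Y < f A" if "dist A X < min \<epsilon>1 \<epsilon>2" "rank X < r" "Y \<in> rfd X" for X Y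
    using 1(3)[of X] 2(2)[of X Y] that by simp
  show ?thesis
  proof (rule that[of "min (min \<epsilon>1 \<epsilon>2 / 2) \<Delta>"])
    show "0 < min (min \<epsilon>1 \<epsilon>2 / 2) \<Delta>" using 1 2 \<Delta>_pos by simp
    fix X Y assume X: "dist A X < min (min \<epsilon>1 \<epsilon>2 / 2) \<Delta>" "rank X \<le> r" and Y: "Y \<in> rfdr X"
    have close: "dist A X < min \<epsilon>1 \<epsilon>2" using X(1) 1(1) 2(1) by linarith
    show "f Y < f A"
    proof (cases "rank X = r")
      case False
      obtain X' where "X' \<in> rfd X" "f Y \<le> f X'" using Y by (rule rfdr_below_rfd)
      then show ?thesis using low[OF close] X(2) False by fastforce
    next
      case True
      have "singular_value r X \<le> dist A X"
        using singular_value_le_dist_rank_lt[of r A X] less r_pos r_less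
        by (simp add: dist_norm norm_minus_commute)
      then have "singular_value r X \<in> {0<..\<Delta>}"
        using X(1) True singular_value_r_pos_iff[of X] by simp
      then obtain H R where H: "H \<in> metric_projection (rank_eq (r - 1)) X" and R: "R \<in> rfd H"
        and "f Y \<le> f R"
        using Y unfolding RFDR_def is_arg_min_linorder by auto
      have "H \<in> metric_projection (rank_le (r - 1)) X"
        using H metric_projection_rank_eq[of "r - 1" X] True r_pos by simp
      then have "dist X H \<le> dist X A"
        using less by (auto simp: metric_projection_iff rank_le_def)
      then have "dist A H < min \<epsilon>1 \<epsilon>2"
        using X(1) dist_triangle[of A H X] by (simp add: dist_commute)
      moreover have "rank H < r"
        using H r_pos by (simp add: metric_projection_iff rank_eq_def)
      ultimately show ?thesis using low R \<open>f Y \<le> f R\<close> by fastforce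
    qed
  qed
qed

section \<open>Convergence to stationary points\<close>

lemma rfdr_sequence_rank_le:
  assumes "RFDR_sequence f r \<alpha>\<^sub>l \<alpha>\<^sub>u \<beta> c \<Delta> X0 X N" "rank X0 \<le> r"
  shows "enat i \<le> N \<Longrightarrow> rank (X i) \<le> r"
proof (induction i)
  case 0
  then show ?case using assms by (simp add: RFDR_sequence_def)
next
  case (Suc i)
  then have "enat i < N" by (simp add: Suc_ile_eq)
  then have "X (Suc i) \<in> rfdr (X i)"
    using assms(1) unfolding RFDR_sequence_def by blast
  moreover have "rank (X i) \<le> r"
    using \<open>enat i < N\<close> by (intro Suc.IH less_imp_le)
  ultimately show ?case by (rule rfdr_rank_le)
qed

lemma accumulation_point_stationary:
  assumes seq: "RFDR_sequence f r \<alpha>\<^sub>l \<alpha>\<^sub>u \<beta> c \<Delta> X0 X \<infinity>" and X0: "rank X0 \<le> r"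
    and \<phi>: "strict_mono \<phi>" "(X \<circ> \<phi>) \<longlonglongrightarrow> A"
  shows "stationary f r A"
proof -
  have rank: "rank (X i) \<le> r" for i
    using rfdr_sequence_rank_le[OF seq X0] by simp
  have step: "X (Suc i) \<in> rfdr (X i)" for i
    using seq by (simp add: RFDR_sequence_def)
  have A: "A \<in> rank_le r"
    by (rule closed_sequentially[OF closed_rank_le _ \<phi>(2)]) (simp add: rank_le_def rank)
  have "decseq (f \<circ> X)"
    by (rule decseq_SucI) (simp add: rfdr_descends[OF step])
  then have "decseq (f \<circ> X \<circ> \<phi>)"
    using \<phi>(1) by (auto simp: decseq_def strict_mono_less_eq)
  moreover have "(f \<circ> X \<circ> \<phi>) \<longlonglongrightarrow> f A"
    using isCont_tendsto_compose[OF f_cont \<phi>(2)] by (simp add: o_def)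
  ultimately have "f A \<le> f (X (\<phi> k))" for k
    using decseq_ge[of "f \<circ> X \<circ> \<phi>" "f A" k] by simp
  moreover have "f (X (\<phi> (Suc k))) \<le> f (X (Suc (\<phi> k)))" for k
    using \<open>decseq (f \<circ> X)\<close> \<phi>(1) by (simp add: decseq_def Suc_le_eq strict_mono_less)
  ultimately have below: "f A \<le> f (X (Suc (\<phi> k)))" for k
    by (meson order_trans)
  have "stationarity_measure f r A = 0"
  proof (rule ccontr)
    assume "stationarity_measure f r A \<noteq> 0"
    then obtain \<epsilon> where "0 < \<epsilon>" and \<epsilon>:
      "\<And>X Y. dist A X < \<epsilon> \<Longrightarrow> rank X \<le> r \<Longrightarrow> Y \<in> rfdr X \<Longrightarrow> f Y < f A"
      using A rfdr_below_near[of A] by (auto simp: rank_le_def)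
    obtain k where "dist ((X \<circ> \<phi>) k) A < \<epsilon>"
      using \<phi>(2) \<open>0 < \<epsilon>\<close> unfolding lim_sequentially by (meson order_refl)
    then have "f (X (Suc (\<phi> k))) < f A"
      by (intro \<epsilon>[OF _ rank step]) (simp add: dist_commute o_def)
    then show False using below[of k] by simp
  qed
  then show ?thesis using A by (simp add: stationary_def)
qed

lemma last_element_stationary:
  assumes seq: "RFDR_sequence f r \<alpha>\<^sub>l \<alpha>\<^sub>u \<beta> c \<Delta> X0 X (enat k)" and X0: "rank X0 \<le> r"
  shows "stationary f r (X k)"
proof -
  have "\<not> 0 < stationarity_measure f r (X k)"
    using seq rfdr_nonempty unfolding RFDR_sequence_def by blast
  then have "stationarity_measure f r (X k) = 0"
    using stationarity_measure_nonneg[of f r "X k"] by linarith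
  then show ?thesis
    using rfdr_sequence_rank_le[OF seq X0, of k] by (simp add: stationary_def rank_le_def)
qed

end

theorem theorem6p2:
  fixes f :: "real^'n^'m \<Rightarrow> real" and r :: nat
    and \<alpha>\<^sub>l \<alpha>\<^sub>u \<beta> c \<Delta> :: real
    and X0 :: "real^'n^'m" and X :: "nat \<Rightarrow> real^'n^'m" and N :: enat
  assumes "0 < r" and "r < min CARD('m) CARD('n)"
    and "\<forall>Z. f differentiable (at Z)"
    and "\<forall>Z. \<exists>e>0. \<exists>L. L-lipschitz_on (ball Z e) (gradient f)"
    and "0 < \<alpha>\<^sub>l" and "\<alpha>\<^sub>l \<le> \<alpha>\<^sub>u"
    and "0 < \<beta>" and "\<beta> < 1" and "0 < c" and "c < 1" and "0 < \<Delta>"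
    and "X0 \<in> rank_le r"
    and "RFDR_sequence f r \<alpha>\<^sub>l \<alpha>\<^sub>u \<beta> c \<Delta> X0 X N"
  shows "(\<forall>k. N = enat k \<longrightarrow> stationary f r (X k)) \<and>
         (N = \<infinity> \<longrightarrow>
            (\<forall>A. (\<exists>\<phi>. strict_mono \<phi> \<and> (X \<circ> \<phi>) \<longlonglongrightarrow> A) \<longrightarrow> stationary f r A))"
proof -
  have cont: "isCont (gradient f) Z" for Z
  proof -
    obtain e L where e: "e > 0" "L-lipschitz_on (ball Z e) (gradient f)"
      using assms(4) by blast
    then have "continuous_on (ball Z e) (gradient f)"
      by (intro lipschitz_on_continuous_on)
    then show ?thesis
      using e(1) by (simp add: continuous_on_eq_continuous_at)
  qed
  interpret rank_constrained_descent f r \<alpha>\<^sub>l \<alpha>\<^sub>u \<beta> c \<Delta>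
    using assms cont by unfold_locales (auto intro: GDERIV_gradient)
  have "rank X0 \<le> r"
    using assms by (simp add: rank_le_def)
  then show ?thesis
    using last_element_stationary accumulation_point_stationary assms(13) by blast
qed

end
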